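(* Let $\mu\in\big(\frac12,1\big)$, let $p_1<p_2$ be real numbers, and let $u_0$ be such that $\mathcal{F}u_0\equiv0$ on $\mathbb{R}\setminus[p_1,p_2]$ and $\mathcal{F}u_0(p)=(p-p_1)^{\mu-1}\tilde u(p)$ for $p\in(p_1,p_2]$, where $\tilde u\in\mathcal{C}^1([p_1,p_2],\mathbb{C})$, $\tilde u(p_1)\neq0$ and $\mathcal{F}u_0(p_2)=0$. Let $u$ be the solution of the free Schrödinger equation with initial datum $u_0$ (see context). Choose $\varepsilon_1,\varepsilon_2>0$ such that $p_1+\varepsilon_1<p_2-\varepsilon_2$. Then there exists a constant $c(u_0,\varepsilon_1,\varepsilon_2)\geqslant0$ such that for all $t\geqslant1$, $$\left|\,\|u(t,\cdot)\|_{L^2(I_t)}-\frac{1}{\sqrt{2\pi}}\,\|\mathcal{F}u_0\|_{L^2(p_1+\varepsilon_1,\,p_2-\varepsilon_2)}\right|\leqslant c(u_0,\varepsilon_1,\varepsilon_2)\,t^{\frac12-\mu},$$ where $I_t:=\big[\,2(p_1+\varepsilon_1)\,t,\ 2(p_2-\varepsilon_2)\,t\,\big]$.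
   Context: The free Schrödinger equation on the line is $[i\partial_t+\partial_x^2]u(t,x)=0$ for $t>0$, $x\in\mathbb{R}$, with $u(0,x)=u_0(x)$. The Fourier transform convention is $\mathcal{F}u_0(p)=\int_{\mathbb{R}}u_0(x)e^{-ixp}\,dx$. If $\mu\in\big(\frac12,1\big)$, $p_1<p_2$ are real numbers, and $u_0$ is such that $\mathcal{F}u_0\equiv0$ on $\mathbb{R}\setminus[p_1,p_2]$ and $\mathcal{F}u_0(p)=(p-p_1)^{\mu-1}\tilde u(p)$ for $p\in(p_1,p_2]$, where $\tilde u\in\mathcal{C}^1([p_1,p_2],\mathbb{C})$, $\tilde u(p_1)\neq0$ and $\mathcal{F}u_0(p_2)=0$, then the solution is given by $$u(t,x)=\frac{1}{2\pi}\int_{p_1}^{p_2}\mathcal{F}u_0(p)\,e^{-itp^2+ixp}\,dp,\qquad t>0,\ x\in\mathbb{R}.$$ *)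

theory Defs
  imports "HOL-Analysis.Analysis"
begin

(* One-sided derivatives are taken at the endpoints when S is a compact interval. *)
definition C1_on :: "real set \<Rightarrow> (real \<Rightarrow> complex) \<Rightarrow> bool" where
  "C1_on S f \<longleftrightarrow>
     (\<exists>f'. continuous_on S f' \<and>
           (\<forall>p\<in>S. (f has_vector_derivative f' p) (at p within S)))"

definition square_integrable :: "(real \<Rightarrow> complex) \<Rightarrow> bool" where
  "square_integrable f \<longleftrightarrow>
     f \<in> borel_measurable lebesgue \<and> integrable lebesgue (\<lambda>x. (cmod (f x))\<^sup>2)"

definition L2_norm_on :: "real set \<Rightarrow> (real \<Rightarrow> complex) \<Rightarrow> real" where
  "L2_norm_on S f = sqrt (LINT x:S|lebesgue. (cmod (f x))\<^sup>2)"

definition truncated_fourier :: "(real \<Rightarrow> complex) \<Rightarrow> real \<Rightarrow> real \<Rightarrow> complex" where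
  "truncated_fourier f R p =
     (LINT x:{-R..R}|lebesgue. f x * exp (- \<i> * of_real (x * p)))"

(* F is a representative of the Fourier transform (Plancherel extension) of the
   L2 function f.  The defining integral over the whole line need not converge
   absolutely for f merely in L2; it is the L2 limit of the integrals over [-R, R].
   In particular, a function whose transform is unbounded is never in L1.
   The extended nonnegative integral is used so that no default value can intervene. *)
definition has_fourier_transform :: "(real \<Rightarrow> complex) \<Rightarrow> (real \<Rightarrow> complex) \<Rightarrow> bool" where
  "has_fourier_transform f F \<longleftrightarrow>
     square_integrable f \<and> square_integrable F \<and>
     ((\<lambda>R. \<integral>\<^sup>+ p. ennreal ((cmod (truncated_fourier f R p - F p))\<^sup>2) \<partial>lebesgue)
        \<longlongrightarrow> 0) at_top"

(* The solution of i u_t + u_xx = 0 whose initial datum has Fourier transform F, where F is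
   integrable and vanishes outside [p1, p2]: the transform of u(t, .) is exp(-i t p^2) F(p),
   and the formula is its inverse transform.  That it solves the equation is shown in
   schrodinger_solution_solves below. *)
definition schrodinger_solution ::
  "real \<Rightarrow> real \<Rightarrow> (real \<Rightarrow> complex) \<Rightarrow> real \<Rightarrow> real \<Rightarrow> complex" where
  "schrodinger_solution p1 p2 F t x =
     (1 / (2 * of_real pi)) *
     (LINT p:{p1..p2}|lebesgue.
        F p * exp (- \<i> * of_real (t * p\<^sup>2) + \<i> * of_real (x * p)))"

lemma has_vector_derivative_oscillatory_integral:
  fixes G :: "real \<Rightarrow> complex" and b :: "real \<Rightarrow> real"
  assumes G: "integrable M G" and b: "b \<in> borel_measurable M"
    and B: "\<And>p. G p \<noteq> 0 \<Longrightarrow> \<bar>b p\<bar> \<le> B"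
  shows "((\<lambda>s. LINT p|M. G p * exp (\<i> * of_real (s * b p))) has_vector_derivative
          (LINT p|M. (\<i> * of_real (b p) * G p) * exp (\<i> * of_real (s * b p)))) (at s)"
    and "integrable M (\<lambda>p. \<i> * of_real (b p) * G p)"
proof -
  have Gm[measurable]: "G \<in> borel_measurable M" using G by auto
  note b[measurable]
  have expm[measurable]: "(\<lambda>p. exp (\<i> * of_real (s * b p))) \<in> borel_measurable M" for s :: real
    by (rule borel_measurable_continuous_on[OF _ b]) (intro continuous_intros)
  show int': "integrable M (\<lambda>p. \<i> * of_real (b p) * G p)"
  proof (rule Bochner_Integration.integrable_bound[of _ "\<lambda>p. complex_of_real B * G p"])
    show "integrable M (\<lambda>p. complex_of_real B * G p)" using G by auto
    show "AE p in M. norm (\<i> * of_real (b p) * G p) \<le> norm (complex_of_real B * G p)"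
    proof (rule AE_I2)
      fix p
      show "norm (\<i> * of_real (b p) * G p) \<le> norm (complex_of_real B * G p)"
      proof (cases "G p = 0")
        case False
        then have "\<bar>b p\<bar> \<le> \<bar>B\<bar>" using B by force
        then show ?thesis by (simp add: norm_mult mult_right_mono)
      qed simp
    qed
  qed measurable
  have intexp: "integrable M (\<lambda>p. H p * exp (\<i> * of_real (s * b p)))"
    if "integrable M H" for H :: "real \<Rightarrow> complex" and s
  proof (rule Bochner_Integration.integrable_bound[OF that])
    have [measurable]: "H \<in> borel_measurable M" using that by auto
    show "(\<lambda>p. H p * exp (\<i> * of_real (s * b p))) \<in> borel_measurable M"
      by measurable
  qed (simp add: norm_mult)
  define f where "f = (\<lambda>s. LINT p|M. G p * exp (\<i> * of_real (s * b p)))"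
  define D where "D = (LINT p|M. (\<i> * of_real (b p) * G p) * exp (\<i> * of_real (s * b p)))"
  define K where "K = B\<^sup>2 * (LINT p|M. norm (G p))"
  have est: "norm (f y - f s - (y - s) *\<^sub>R D) \<le> K * \<bar>y - s\<bar>\<^sup>2" for y
  proof -
    let ?h = "\<lambda>p. G p * exp (\<i> * of_real (y * b p)) - G p * exp (\<i> * of_real (s * b p))
       - (y - s) *\<^sub>R ((\<i> * of_real (b p) * G p) * exp (\<i> * of_real (s * b p)))"
    have eq: "f y - f s - (y - s) *\<^sub>R D = (LINT p|M. ?h p)"
      unfolding f_def D_def
      by (simp add: intexp[OF G] intexp[OF int'] del: of_real_mult)
    have "norm (LINT p|M. ?h p) \<le> (LINT p|M. (B\<^sup>2 * \<bar>y - s\<bar>\<^sup>2) * norm (G p))"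
    proof (rule Bochner_Integration.integral_norm_bound_integral)
      show "integrable M ?h"
        by (rule Bochner_Integration.integrable_diff[OF Bochner_Integration.integrable_diff
              [OF intexp[OF G] intexp[OF G]] integrable_scaleR_right[OF intexp[OF int']]])
      show "integrable M (\<lambda>p. (B\<^sup>2 * \<bar>y - s\<bar>\<^sup>2) * norm (G p))" using G by auto
      fix p
      define \<delta> where "\<delta> = (y - s) * b p"
      have e: "exp (\<i> * of_real (y * b p)) = exp (\<i> * of_real (s * b p)) * exp (\<i> * of_real \<delta>)"
        by (simp add: \<delta>_def exp_add[symmetric] algebra_simps)
      have "?h p = G p * exp (\<i> * of_real (s * b p)) * (exp (\<i> * of_real \<delta>) - (1 + \<i> * of_real \<delta>))"
        unfolding e by (simp add: \<delta>_def scaleR_conv_of_real algebra_simps)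
      then have n: "norm (?h p) = norm (G p) * norm (exp (\<i> * of_real \<delta>) - (1 + \<i> * of_real \<delta>))"
        by (simp add: norm_mult)
      have "norm (exp (\<i> * of_real \<delta>) - (\<Sum>k\<le>1. (\<i> * of_real \<delta>) ^ k / fact k))
            \<le> exp \<bar>Re (\<i> * of_real \<delta>)\<bar> * (norm (\<i> * of_real \<delta>) ^ Suc 1) / fact 1"
        by (rule Taylor_exp)
      then have "norm (exp (\<i> * of_real \<delta>) - (1 + \<i> * of_real \<delta>)) \<le> \<bar>\<delta>\<bar>\<^sup>2"
        by (simp add: norm_mult power2_eq_square)
      moreover have "\<bar>\<delta>\<bar>\<^sup>2 \<le> B\<^sup>2 * \<bar>y - s\<bar>\<^sup>2" if "G p \<noteq> 0"
      proof -
        have "(b p)\<^sup>2 \<le> B\<^sup>2"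
          using power_mono[OF B[OF that], of 2] by simp
        then have "(b p)\<^sup>2 * (y - s)\<^sup>2 \<le> B\<^sup>2 * (y - s)\<^sup>2"
          by (rule mult_right_mono) simp
        then show ?thesis by (simp add: \<delta>_def power_mult_distrib mult.commute)
      qed
      ultimately have "norm (exp (\<i> * of_real \<delta>) - (1 + \<i> * of_real \<delta>)) \<le> B\<^sup>2 * \<bar>y - s\<bar>\<^sup>2"
        if "G p \<noteq> 0"
        using that by (meson order_trans)
      then show "norm (?h p) \<le> (B\<^sup>2 * \<bar>y - s\<bar>\<^sup>2) * norm (G p)"
        unfolding n mult.commute[of "norm (G p)"]
        by (cases "G p = 0") (simp, blast intro: mult_right_mono norm_ge_zero)
    qed
    also have "\<dots> = K * \<bar>y - s\<bar>\<^sup>2" by (simp add: K_def)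
    finally show ?thesis unfolding eq .
  qed
  have "((\<lambda>y. norm (f y - f s - (y - s) *\<^sub>R D) / norm (y - s)) \<longlongrightarrow> 0) (at s)"
  proof (rule Lim_null_comparison[where g="\<lambda>y. K * \<bar>y - s\<bar>"])
    have "norm (f y - f s - (y - s) *\<^sub>R D) / norm (y - s) \<le> K * \<bar>y - s\<bar>" if "y \<noteq> s" for y
      using est[of y] that by (simp add: pos_divide_le_eq power2_eq_square mult.assoc)
    then show "\<forall>\<^sub>F y in at s. norm (norm (f y - f s - (y - s) *\<^sub>R D) / norm (y - s)) \<le> K * \<bar>y - s\<bar>"
      by (simp add: eventually_at_filter)
    show "((\<lambda>y. K * \<bar>y - s\<bar>) \<longlongrightarrow> 0) (at s)"
      by (auto intro!: tendsto_eq_intros)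
  qed
  then have "(f has_vector_derivative D) (at s)"
    unfolding has_vector_derivative_def has_derivative_iff_norm
    by (simp add: bounded_linear_scaleR_left)
  then show "((\<lambda>s. LINT p|M. G p * exp (\<i> * of_real (s * b p))) has_vector_derivative
          (LINT p|M. (\<i> * of_real (b p) * G p) * exp (\<i> * of_real (s * b p)))) (at s)"
    unfolding f_def D_def .
qed

lemma schrodinger_solution_solves:
  fixes F :: "real \<Rightarrow> complex"
  assumes F: "set_integrable lebesgue {p1..p2} F"
  defines "u \<equiv> schrodinger_solution p1 p2 F"
  obtains ut ux uxx :: "real \<Rightarrow> real \<Rightarrow> complex"
  where "\<And>t x. ((\<lambda>s. u s x) has_vector_derivative ut t x) (at t)"
    and "\<And>t x. ((\<lambda>y. u t y) has_vector_derivative ux t x) (at x)"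
    and "\<And>t x. ((\<lambda>y. ux t y) has_vector_derivative uxx t x) (at x)"
    and "\<And>t x. \<i> * ut t x + uxx t x = 0"
proof
  define C where "C = 1 / (2 * complex_of_real pi)"
  define G where "G = (\<lambda>p. indicator {p1..p2} p *\<^sub>R F p)"
  define B where "B = \<bar>p1\<bar> + \<bar>p2\<bar>"
  have G: "integrable lebesgue G"
    using F by (simp add: G_def set_integrable_def)
  have B: "\<bar>p\<bar> \<le> B" if "G p \<noteq> 0" for p
    using that by (auto simp: G_def B_def indicator_def split: if_splits)
  have B2: "\<bar>- p\<^sup>2\<bar> \<le> B\<^sup>2" if "G p \<noteq> 0" for p
    using power_mono[OF B[OF that], of 2] by simp
  have B0: "B \<ge> 0" by (simp add: B_def)
  define Et where "Et = (\<lambda>t p. exp (\<i> * of_real (t * (- p\<^sup>2))))"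
  define Ex where "Ex = (\<lambda>x p. exp (\<i> * of_real (x * p)))"
  have mt: "Et t \<in> borel_measurable lebesgue" for t :: real
    unfolding Et_def
    by (intro measurable_completion, unfold measurable_lborel2)
       (intro borel_measurable_continuous_onI continuous_intros)
  have mx: "Ex x \<in> borel_measurable lebesgue" for x :: real
    unfolding Ex_def
    by (intro measurable_completion, unfold measurable_lborel2)
       (intro borel_measurable_continuous_onI continuous_intros)
  have int_mult: "integrable lebesgue (\<lambda>p. H p * E p)"
    if "integrable lebesgue H" "E \<in> borel_measurable lebesgue" "\<And>p. norm (E p) = 1"
    for H E :: "real \<Rightarrow> complex"
    by (rule Bochner_Integration.integrable_bound[OF that(1)])
       (use that borel_measurable_integrable[OF that(1)] in \<open>auto simp: norm_mult\<close>)
  have nt: "norm (Et t p) = 1" and nx: "norm (Ex x p) = 1" for t x p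
    unfolding Et_def Ex_def by (simp_all only: norm_exp_i_times)
  have mb: "(\<lambda>p::real. p) \<in> borel_measurable lebesgue"
    and mb2: "(\<lambda>p::real. - p\<^sup>2) \<in> borel_measurable lebesgue"
    by (rule measurable_completion, simp)+
  have u: "u t x = C * (LINT p|lebesgue. G p * Et t p * Ex x p)" for t x
  proof -
    have "indicator {p1..p2} p *\<^sub>R (F p * exp (- \<i> * of_real (t * p\<^sup>2) + \<i> * of_real (x * p)))
          = G p * Et t p * Ex x p" for p
      by (simp add: G_def Et_def Ex_def exp_add[symmetric] scaleR_conv_of_real)
    then show ?thesis
      unfolding u_def schrodinger_solution_def set_lebesgue_integral_def C_def by (simp only:)
  qed
  define ut where "ut = (\<lambda>t x. C * (LINT p|lebesgue. (\<i> * of_real (- p\<^sup>2) * (G p * Ex x p)) * Et t p))"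
  define ux where "ux = (\<lambda>t x. C * (LINT p|lebesgue. (\<i> * of_real p * (G p * Et t p)) * Ex x p))"
  define uxx where "uxx = (\<lambda>t x. C * (LINT p|lebesgue.
      (\<i> * of_real p * (\<i> * of_real p * (G p * Et t p))) * Ex x p))"
  show "((\<lambda>s. u s x) has_vector_derivative ut t x) (at t)" for t x
  proof -
    have "((\<lambda>s. LINT p|lebesgue. (G p * Ex x p) * Et s p) has_vector_derivative
      (LINT p|lebesgue. (\<i> * of_real (- p\<^sup>2) * (G p * Ex x p)) * Et t p)) (at t)"
      unfolding Et_def
      by (rule has_vector_derivative_oscillatory_integral(1)[OF int_mult[OF G mx nx] mb2, of _ "B\<^sup>2"])
         (use B2 in auto)
    then show ?thesis
      unfolding u ut_def by (intro has_vector_derivative_mult_right) (simp add: ac_simps)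
  qed
  note x1 = has_vector_derivative_oscillatory_integral[OF int_mult[OF G mt nt] mb, of _ B]
  show "((\<lambda>y. u t y) has_vector_derivative ux t x) (at x)" for t x
    unfolding u ux_def
    by (intro has_vector_derivative_mult_right, unfold Ex_def) (rule x1(1), use B in auto)
  show "((\<lambda>y. ux t y) has_vector_derivative uxx t x) (at x)" for t x
  proof -
    have i: "integrable lebesgue (\<lambda>p. \<i> * of_real p * (G p * Et t p))"
      by (rule x1(2)) (use B in auto)
    show ?thesis
      unfolding ux_def uxx_def
      by (intro has_vector_derivative_mult_right, unfold Ex_def)
         (rule has_vector_derivative_oscillatory_integral(1)[OF i mb, of B], use B in auto)
  qed
  show "\<i> * ut t x + uxx t x = 0" for t x
  proof -
    have "\<i> * ut t x = C * (LINT p|lebesgue. \<i> * ((\<i> * of_real (- p\<^sup>2) * (G p * Ex x p)) * Et t p))"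
      unfolding ut_def by simp
    also have "(\<lambda>p. \<i> * ((\<i> * of_real (- p\<^sup>2) * (G p * Ex x p)) * Et t p)) =
       (\<lambda>p. - ((\<i> * of_real p * (\<i> * of_real p * (G p * Et t p))) * Ex x p))"
      by (simp add: fun_eq_iff power2_eq_square algebra_simps)
    finally show ?thesis unfolding uxx_def by simp
  qed
qed

end

theory Submission
  imports Defs "HOL-Probability.Distributions" "HOL-Real_Asymp.Real_Asymp"
begin

text \<open>
  On the ray \<open>x = 2 q t\<close> the phase is \<open>t q\<^sup>2 - t (p - q)\<^sup>2\<close>, so \<open>|u(t, 2 q t)|\<close> is \<open>1 / (2 \<pi>)\<close> times the
  modulus of the integral of \<open>F(p) exp(- i t (p - q)\<^sup>2)\<close>. Integrating by parts on both sides of \<open>q\<close>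
  against the tail \<open>T\<close> of the Fresnel integral produces the main term \<open>2 F(q) T(0)\<close>, of modulus
  \<open>|F(q)| sqrt(\<pi> / t)\<close>. As \<open>|T(y)|\<close> is at most \<open>2 / (sqrt t (1 + sqrt t y))\<close>, the regular part of the
  remainder is \<open>O(log t / t)\<close>; near the singular end \<open>p1\<close> the integration by parts stops at distance
  of order \<open>1 / t\<close>, and all contributions from there are \<open>O(t powr - \<mu>)\<close>, uniformly for \<open>q\<close> away
  from \<open>p1\<close>. Taking \<open>L\<^sup>2\<close> norms over the interval \<open>I\<^sub>t\<close> of length \<open>O(t)\<close> costs a factor \<open>sqrt t\<close>.
\<close>

section \<open>Tails of the Fresnel integral\<close>

lemma norm_exp_minus_linear_le:
  fixes w v :: complex
  assumes "Re w \<le> 0" "Re v \<le> 0"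
  shows "norm (exp w - exp v - (w - v) * exp v) \<le> norm (w - v) ^ 2"
proof -
  \<comment> \<open>The closed left half-plane is convex and \<open>exp\<close>, its own derivative
    of every order, has modulus at most 1 there, so Taylor's formula applies with bound 1.\<close>
  have "norm (exp w - (\<Sum>i\<le>1. exp v * (w - v) ^ i / fact i)) \<le> 1 * norm (w - v) ^ Suc 1 / fact 1"
  proof (rule complex_Taylor[where S="{z. Re z \<le> 0}" and f="\<lambda>_. exp"])
    show "convex {z. Re z \<le> 0}" by (rule convex_halfspace_Re_le)
  qed (use assms in \<open>auto intro!: derivative_eq_intros\<close>)
  then show ?thesis by (simp add: algebra_simps power2_eq_square)
qed

text \<open>The increments stay in \<open>{0..}\<close>, so on the support of \<open>w\<close> all
  exponents lie in the left half-plane. There the first-order Taylor remainder of the integrand is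
  quadratic in the increment, and the second moment of \<open>w\<close> makes this bound
  integrable.\<close>

lemma has_vector_derivative_laplace_integral:
  fixes w :: "real \<Rightarrow> real" and \<kappa> :: complex
  assumes int: "\<And>k. k \<le> 2 \<Longrightarrow> integrable lborel (\<lambda>r. w r * r ^ k)"
    and w: "\<And>r. 0 \<le> w r" "\<And>r. r < 0 \<Longrightarrow> w r = 0"
    and \<kappa>: "Re \<kappa> \<ge> 0" and z: "z \<ge> 0"
  shows "((\<lambda>z. LINT r|lborel. w r *\<^sub>R exp (- \<kappa> * of_real (z * r))) has_vector_derivative
          (LINT r|lborel. w r *\<^sub>R (- \<kappa> * of_real r * exp (- \<kappa> * of_real (z * r)))))
          (at z within {0..})" (is "(?f has_vector_derivative ?D) _")
    and "k \<le> 1 \<Longrightarrow>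
         integrable lborel (\<lambda>r. (w r * r ^ k) *\<^sub>R exp (- \<kappa> * of_real (z * r)))"
proof -
  have bnd: "norm (exp (- \<kappa> * of_real (y * r))) \<le> 1" if "y \<ge> 0" "r \<ge> 0" for y r
    using that \<kappa> by simp
  have intexp: "integrable lborel (\<lambda>r. (w r * r ^ k) *\<^sub>R exp (- \<kappa> * of_real (y * r)))"
    if "y \<ge> 0" "k \<le> 1" for y and k :: nat
  proof (rule Bochner_Integration.integrable_bound[OF int[of k]])
    have [measurable]: "(\<lambda>r. w r * r ^ k) \<in> borel_measurable lborel"
      using int[of k] that by auto
    have [measurable]: "(\<lambda>r. exp (- \<kappa> * of_real (y * r))) \<in> borel_measurable lborel"
      unfolding measurable_lborel2 by (intro borel_measurable_continuous_onI continuous_intros)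
    show "(\<lambda>r. (w r * r ^ k) *\<^sub>R exp (- \<kappa> * of_real (y * r))) \<in> borel_measurable lborel"
      by measurable
    show "AE r in lborel. norm ((w r * r ^ k) *\<^sub>R exp (- \<kappa> * of_real (y * r))) \<le> norm (w r * r ^ k)"
    proof (rule AE_I2)
      fix r show "norm ((w r * r ^ k) *\<^sub>R exp (- \<kappa> * of_real (y * r))) \<le> norm (w r * r ^ k)"
        using bnd[OF that(1), of r] w(2)[of r] mult_left_le[of _ "\<bar>w r * r ^ k\<bar>"]
        by (cases "r < 0") (auto simp del: norm_exp_eq_Re)
    qed
  qed (use that in auto)
  then show "k \<le> 1 \<Longrightarrow>
         integrable lborel (\<lambda>r. (w r * r ^ k) *\<^sub>R exp (- \<kappa> * of_real (z * r)))"
    using z by blast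
  define K where "K = (LINT r|lborel. w r * r ^ 2) * (norm \<kappa>)\<^sup>2"
  have est: "norm (?f y - ?f z - (y - z) *\<^sub>R ?D) \<le> K * \<bar>y - z\<bar>\<^sup>2" if y: "y \<ge> 0" for y
  proof -
    let ?e = "\<lambda>y r. exp (- \<kappa> * of_real (y * r))"
    let ?h = "\<lambda>r. w r *\<^sub>R ?e y r - w r *\<^sub>R ?e z r - (y - z) *\<^sub>R (w r *\<^sub>R (- \<kappa> * of_real r * ?e z r))"
    have i0: "integrable lborel (\<lambda>r. w r *\<^sub>R ?e y r)" if "y \<ge> 0" for y
      using intexp[OF that, of 0] by simp
    have i1: "integrable lborel (\<lambda>r. w r *\<^sub>R (- \<kappa> * of_real r * ?e z r))"
      using integrable_mult_right[OF intexp[OF z, of 1], of "- \<kappa>"]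
      by (simp add: scaleR_conv_of_real mult_ac)
    have ih: "integrable lborel ?h"
      by (intro Bochner_Integration.integrable_diff integrable_scaleR_right i0 i1 y z)
    have eq: "?f y - ?f z - (y - z) *\<^sub>R ?D = (LINT r|lborel. ?h r)"
      by (subst Bochner_Integration.integral_diff
          [OF Bochner_Integration.integrable_diff[OF i0[OF y] i0[OF z]] integrable_scaleR_right[OF i1]],
          subst Bochner_Integration.integral_diff[OF i0[OF y] i0[OF z]], simp only: integral_scaleR_right)
    have "norm (LINT r|lborel. ?h r) \<le> (LINT r|lborel. ((norm \<kappa>)\<^sup>2 * \<bar>y - z\<bar>\<^sup>2) * (w r * r ^ 2))"
    proof (rule Bochner_Integration.integral_norm_bound_integral[OF ih])
      show "integrable lborel (\<lambda>r. ((norm \<kappa>)\<^sup>2 * \<bar>y - z\<bar>\<^sup>2) * (w r * r ^ 2))"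
        using int[of 2] by (intro integrable_mult_right) auto
      fix r :: real
      show "norm (?h r) \<le> ((norm \<kappa>)\<^sup>2 * \<bar>y - z\<bar>\<^sup>2) * (w r * r ^ 2)"
      proof (cases "r < 0")
        case False
        \<comment> \<open>Regrouped, the integrand is \<open>w r\<close> times the Taylor remainder
          of \<open>exp\<close> between the two exponents.\<close>
        have "?h r = w r *\<^sub>R (?e y r - ?e z r -
             (- \<kappa> * of_real (y * r) - - \<kappa> * of_real (z * r)) * ?e z r)"
          by (simp add: scaleR_conv_of_real algebra_simps)
        also have "norm \<dots> \<le> w r * norm (- \<kappa> * of_real (y * r) - - \<kappa> * of_real (z * r)) ^ 2"
          using False \<kappa> y z w(1)[of r]
          by (subst norm_scaleR, intro mult_mono norm_exp_minus_linear_le) auto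
        also have "- \<kappa> * of_real (y * r) - - \<kappa> * of_real (z * r) = \<kappa> * of_real ((z - y) * r)"
          by (simp add: algebra_simps)
        also have "w r * norm \<dots> ^ 2 = ((norm \<kappa>)\<^sup>2 * \<bar>y - z\<bar>\<^sup>2) * (w r * r ^ 2)"
          by (simp only: norm_mult norm_of_real abs_mult power_mult_distrib power2_abs power2_commute[of y] ac_simps)
        finally show ?thesis .
      qed (simp add: w(2))
    qed
    also have "\<dots> = K * \<bar>y - z\<bar>\<^sup>2" by (simp add: K_def)
    finally show ?thesis unfolding eq .
  qed
  have "((\<lambda>y. norm (?f y - ?f z - (y - z) *\<^sub>R ?D) / norm (y - z)) \<longlongrightarrow> 0) (at z within {0..})"
  proof (rule Lim_null_comparison[where g="\<lambda>y. K * \<bar>y - z\<bar>"])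
    have "norm (?f y - ?f z - (y - z) *\<^sub>R ?D) / norm (y - z) \<le> K * \<bar>y - z\<bar>"
      if "y \<noteq> z" "y \<ge> 0" for y
      using est[of y] that by (simp add: pos_divide_le_eq power2_eq_square mult.assoc)
    then show "\<forall>\<^sub>F y in at z within {0..}.
        norm (norm (?f y - ?f z - (y - z) *\<^sub>R ?D) / norm (y - z)) \<le> K * \<bar>y - z\<bar>"
      by (simp add: eventually_at_filter)
    show "((\<lambda>y. K * \<bar>y - z\<bar>) \<longlongrightarrow> 0) (at z within {0..})"
      by (auto intro!: tendsto_eq_intros)
  qed
  then show "(?f has_vector_derivative ?D) (at z within {0..})"
    unfolding has_vector_derivative_def has_derivative_iff_norm
    by (simp only: bounded_linear_scaleR_left simp_thms)
qed

section \<open>The Fresnel tail on a rotated contour\<close>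

definition fresnel_rate :: complex where
  "fresnel_rate = of_real (sqrt 2) * (1 + \<i>)"

text \<open>On the ray \<open>y = z + cis (- pi / 4) * r\<close> the function
  \<open>exp (- \<i> * y\<^sup>2)\<close> factors into \<open>cis (- z\<^sup>2)\<close>, the decay
  \<open>exp (- fresnel_rate * z * r)\<close> with
  \<open>fresnel_rate = 2 * \<i> * cis (- pi / 4)\<close>, and this Gaussian. The indicator turns
  integrals over the ray into integrals over the line.\<close>

definition gauss_weight :: "real \<Rightarrow> real" where
  "gauss_weight r = indicator {0..} r * exp (- r\<^sup>2)"

text \<open>The improper integral of \<open>cis (- y\<^sup>2)\<close> over \<open>y \<ge> z\<close>, with the contour rotated to
  \<open>y = z + cis (- pi / 4) * r\<close>, \<open>r \<ge> 0\<close>, which makes it absolutely convergent. The rotation itself is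
  never justified: only the derivative, the value at 0 and the decay of the result matter.\<close>

definition fresnel_tail :: "real \<Rightarrow> complex" where
  "fresnel_tail z = cis (- pi / 4) * cis (- z\<^sup>2) *
     (LINT r|lborel. gauss_weight r *\<^sub>R exp (- fresnel_rate * of_real (z * r)))"

lemma gauss_weight_nonneg: "0 \<le> gauss_weight r"
  and gauss_weight_neg: "r < 0 \<Longrightarrow> gauss_weight r = 0"
  by (auto simp: gauss_weight_def)

lemma gauss_weight_integral: "has_bochner_integral lborel gauss_weight (sqrt pi / 2)"
  using gaussian_moment_even_pos[of 0] by (simp add: gauss_weight_def[abs_def])

lemma gauss_weight_moment:
  assumes "k \<le> 2"
  shows "integrable lborel (\<lambda>r. gauss_weight r * r ^ k)"
proof -
  consider "k = 0" | "k = 1" | "k = 2" using assms by linarith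
  then show ?thesis
  proof cases
    case 1
    then show ?thesis using gauss_weight_integral by (simp add: has_bochner_integral_iff)
  next
    case 2
    then show ?thesis using gaussian_moment_odd_pos[of 0]
      by (simp add: has_bochner_integral_iff gauss_weight_def mult.assoc)
  next
    case 3
    then show ?thesis using gaussian_moment_even_pos[of 1]
      by (simp add: has_bochner_integral_iff gauss_weight_def mult.assoc)
  qed
qed

lemma Re_fresnel_rate: "Re fresnel_rate = sqrt 2"
  by (simp add: fresnel_rate_def)

lemma fresnel_rate_square: "fresnel_rate\<^sup>2 = 4 * \<i>"
  by (simp add: fresnel_rate_def power2_eq_square algebra_simps flip: of_real_mult)

lemma fresnel_rate_rotate: "cis (- pi / 4) * fresnel_rate = 2"
  by (simp add: fresnel_rate_def complex_eq_iff cos_45 sin_45 field_simps)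

lemma norm_fresnel_tail_0: "norm (fresnel_tail 0) = sqrt pi / 2"
proof -
  have "(LINT r|lborel. gauss_weight r *\<^sub>R exp (- fresnel_rate * of_real (0 * r))) = of_real (sqrt pi / 2)"
    using has_bochner_integral_integral_eq[OF gauss_weight_integral]
    by (simp add: scaleR_conv_of_real del: of_real_divide)
  then show ?thesis by (simp add: fresnel_tail_def norm_mult del: of_real_divide)
qed

text \<open>Without the exponential the integral is at most \<open>sqrt pi / 2\<close>, hence at
  most 1; without the Gaussian it is at most \<open>1 / z\<close>. Adding the bounds on
  \<open>norm ?I\<close> and \<open>z * norm ?I\<close> yields one estimate good both near 0 and at
  infinity.\<close>

lemma norm_fresnel_tail_le:
  assumes "z \<ge> 0"
  shows "norm (fresnel_tail z) \<le> 2 / (1 + z)"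
proof -
  let ?I = "LINT r|lborel. gauss_weight r *\<^sub>R exp (- fresnel_rate * of_real (z * r))"
  have i: "integrable lborel (\<lambda>r. gauss_weight r *\<^sub>R exp (- fresnel_rate * of_real (z * r)))"
    using has_vector_derivative_laplace_integral(2)[OF gauss_weight_moment gauss_weight_nonneg gauss_weight_neg,
        of fresnel_rate z 0] assms by (simp add: Re_fresnel_rate)
  have n: "norm (fresnel_tail z) = norm ?I"
    by (simp add: fresnel_tail_def norm_mult)
  have nint: "norm (gauss_weight r *\<^sub>R exp (- fresnel_rate * of_real (z * r)))
       = gauss_weight r * exp (- sqrt 2 * z * r)" for r
    using gauss_weight_nonneg[of r] by (simp add: Re_fresnel_rate)
  have "norm ?I \<le> (LINT r|lborel. gauss_weight r)"
  proof (rule Bochner_Integration.integral_norm_bound_integral[OF i])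
    show "integrable lborel gauss_weight" using gauss_weight_moment[of 0] by simp
    show "norm (gauss_weight r *\<^sub>R exp (- fresnel_rate * of_real (z * r))) \<le> gauss_weight r" for r
      unfolding nint using assms by (cases "r < 0") (auto simp: gauss_weight_def)
  qed
  also have "\<dots> = sqrt pi / 2"
    using gauss_weight_integral by (simp add: has_bochner_integral_iff)
  finally have b0: "norm ?I \<le> sqrt pi / 2" .
  have b1: "z * norm ?I \<le> 1"
  proof (cases "z = 0")
    case False
    then have z: "z > 0" using assms by simp
    have hi: "has_bochner_integral lborel (\<lambda>r. indicator {0..} r * exp (- z * r)) (1 / z)"
      (is "has_bochner_integral _ ?e _")
    proof (rule has_bochner_integral_nn_integral)
      have "((\<lambda>r. - (exp (- z * r) / z)) \<longlongrightarrow> 0) at_top" using z by real_asymp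
      then have "(\<integral>\<^sup>+r. ennreal (exp (- z * r)) * indicator {0..} r \<partial>lborel) = 0 - (- (exp (- z * 0) / z))"
        using z by (intro nn_integral_FTC_atLeast) (auto intro!: derivative_eq_intros)
      then show "(\<integral>\<^sup>+r. ennreal (?e r) \<partial>lborel) = ennreal (1 / z)"
        by (simp add: ennreal_mult' ennreal_indicator mult.commute)
    qed (use z in \<open>auto simp: indicator_def\<close>)
    have "norm ?I \<le> (LINT r|lborel. ?e r)"
    proof (rule Bochner_Integration.integral_norm_bound_integral[OF i])
      show "integrable lborel ?e" using hi by (simp add: has_bochner_integral_iff)
      fix r :: real
      have "exp (- r\<^sup>2) * exp (- sqrt 2 * z * r) \<le> exp (- z * r)" if "r \<ge> 0"
      proof -
        have "z * r * 1 \<le> z * r * sqrt 2" using z that by (intro mult_left_mono) auto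
        then have "z * r \<le> sqrt 2 * z * r" by (simp add: mult_ac)
        then have "- r\<^sup>2 + - sqrt 2 * z * r \<le> - z * r"
          using zero_le_power2[of r] by linarith
        then show ?thesis by (simp only: mult_exp_exp exp_le_cancel_iff)
      qed
      then show "norm (gauss_weight r *\<^sub>R exp (- fresnel_rate * of_real (z * r))) \<le> ?e r"
        unfolding nint by (auto simp: gauss_weight_def indicator_def)
    qed
    also have "\<dots> = 1 / z" using hi by (simp add: has_bochner_integral_iff)
    finally show ?thesis using z by (simp add: field_simps)
  qed simp
  have "sqrt pi \<le> 2" using pi_less_4 real_sqrt_le_mono[of pi 4] by simp
  then have "(1 + z) * norm ?I \<le> 2" using b0 b1 by (simp add: algebra_simps)
  then show ?thesis using assms unfolding n by (simp add: field_simps)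
qed

text \<open>The product rule leaves the two integrals \<open>I\<close> and \<open>R\<close>, and an
  integration by parts in \<open>r\<close> combines them into the constant 1. The derivative
  expected of the improper integral thus appears without any contour argument.\<close>

lemma fresnel_tail_has_vector_derivative:
  assumes z: "z \<ge> 0"
  shows "(fresnel_tail has_vector_derivative - cis (- z\<^sup>2)) (at z within {0..})"
proof -
  let ?\<kappa> = fresnel_rate
  let ?e = "\<lambda>r. exp (- ?\<kappa> * of_real (z * r))"
  define I where "I = (LINT r|lborel. gauss_weight r *\<^sub>R ?e r)"
  define R where "R = (LINT r|lborel. (gauss_weight r * r) *\<^sub>R ?e r)"
  note L = has_vector_derivative_laplace_integral[OF gauss_weight_moment gauss_weight_nonneg gauss_weight_neg,
      of ?\<kappa> z]
  have i0: "integrable lborel (\<lambda>r. gauss_weight r *\<^sub>R ?e r)"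
    using L(2)[of 0] z by (simp add: Re_fresnel_rate)
  have i1: "integrable lborel (\<lambda>r. (gauss_weight r * r) *\<^sub>R ?e r)"
    using L(2)[of 1] z by (simp add: Re_fresnel_rate)
  have D: "((\<lambda>z. LINT r|lborel. gauss_weight r *\<^sub>R exp (- ?\<kappa> * of_real (z * r)))
      has_vector_derivative - ?\<kappa> * R) (at z within {0..})"
  proof -
    have "(LINT r|lborel. gauss_weight r *\<^sub>R (- ?\<kappa> * of_real r * ?e r))
         = (LINT r|lborel. - ?\<kappa> * ((gauss_weight r * r) *\<^sub>R ?e r))"
      by (rule Bochner_Integration.integral_cong) (auto simp: scaleR_conv_of_real)
    also have "\<dots> = - ?\<kappa> * R" unfolding R_def by (rule Bochner_Integration.integral_mult_right) (use i1 in simp)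
    finally show ?thesis using L(1) z by (simp add: Re_fresnel_rate)
  qed
  \<comment> \<open>The integrand is the exact derivative of
    \<open>- exp (- r\<^sup>2 - fresnel_rate * z * r)\<close>, whose boundary values are -1 at 0 and
    0 at infinity.\<close>
  have parts: "2 * R + ?\<kappa> * of_real z * I = 1"
  proof -
    let ?E = "\<lambda>r. - exp (- of_real (r\<^sup>2) - ?\<kappa> * of_real (z * r))"
    let ?f = "\<lambda>r. (2 * of_real r + ?\<kappa> * of_real z) * exp (- of_real (r\<^sup>2) - ?\<kappa> * of_real (z * r))"
    have eq: "indicator {0..} r *\<^sub>R ?f r
        = 2 * ((gauss_weight r * r) *\<^sub>R ?e r) + ?\<kappa> * of_real z * (gauss_weight r *\<^sub>R ?e r)" for r
      by (auto simp: gauss_weight_def indicator_def scaleR_conv_of_real exp_diff exp_minus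
          exp_of_real field_simps simp flip: of_real_power)
    have int: "set_integrable lborel {0..} ?f"
      unfolding set_integrable_def eq
      by (intro Bochner_Integration.integrable_add Bochner_Integration.integrable_mult_right i0 i1)
    have "(LBINT r=ereal 0..\<infinity>. ?f r) = 0 - (- 1)"
    proof (rule interval_integral_FTC_integrable[where F="?E"])
      show "(?E has_vector_derivative ?f x) (at x)" for x
      proof -
        have "((\<lambda>w. - exp (- w\<^sup>2 - ?\<kappa> * (of_real z * w))) has_field_derivative
            (2 * of_real x + ?\<kappa> * of_real z) * exp (- (of_real x)\<^sup>2 - ?\<kappa> * (of_real z * of_real x)))
            (at (of_real x))"
          by (auto intro!: derivative_eq_intros simp: algebra_simps)
        from has_vector_derivative_real_field[OF this] show ?thesis by simp
      qed
      show "isCont ?f x" for x by (intro continuous_intros)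
      show "set_integrable lborel (einterval (ereal 0) \<infinity>) ?f"
        by (rule set_integrable_subset[OF int]) auto
      have "((\<lambda>r. ?E r) \<longlongrightarrow> ?E 0) (at_right 0)"
        by (intro tendsto_intros)
      then show "((?E \<circ> real_of_ereal) \<longlongrightarrow> - 1) (at_right (ereal 0))"
        by (simp add: ereal_tendsto_simps1)
      have "(?E \<longlongrightarrow> 0) at_top"
      proof (rule Lim_null_comparison)
        show "\<forall>\<^sub>F r in at_top. norm (?E r) \<le> exp (- r\<^sup>2)"
          using eventually_ge_at_top[of 0] by eventually_elim (use z in \<open>simp add: Re_fresnel_rate\<close>)
        show "((\<lambda>r::real. exp (- r\<^sup>2)) \<longlongrightarrow> 0) at_top" by real_asymp
      qed
      then show "((?E \<circ> real_of_ereal) \<longlongrightarrow> 0) (at_left \<infinity>)"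
        by (simp add: ereal_tendsto_simps1)
    qed simp
    \<comment> \<open>The interval integral omits the endpoint 0, a null set.\<close>
    also have "(LBINT r=ereal 0..\<infinity>. ?f r) = (LINT r:{0..}|lborel. ?f r)"
      unfolding interval_integral_to_infinity_eq set_lebesgue_integral_def
      using int AE_lborel_singleton[of "0::real"]
      by (intro integral_cong_AE) (auto simp: indicator_def set_integrable_def
          intro: set_integrable_subset[OF int, unfolded set_integrable_def] elim: eventually_mono)
    also have "\<dots> = 2 * R + ?\<kappa> * of_real z * I"
      unfolding set_lebesgue_integral_def eq I_def R_def
      by (subst Bochner_Integration.integral_add, (intro Bochner_Integration.integrable_mult_right i0 i1)+,
          subst (1 2) Bochner_Integration.integral_mult_right, use i0 i1 in simp_all)
    finally show ?thesis by simp
  qed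
  have "((\<lambda>z. cis (- z\<^sup>2)) has_vector_derivative (- 2 * \<i> * of_real z) * cis (- z\<^sup>2)) (at z within {0..})"
  proof -
    have "((\<lambda>w. exp (\<i> * - w\<^sup>2)) has_field_derivative
        (- 2 * \<i> * of_real z) * exp (\<i> * - (of_real z)\<^sup>2)) (at (of_real z))"
      by (auto intro!: derivative_eq_intros)
    from has_vector_derivative_real_field[OF this] show ?thesis
      unfolding cis_conv_exp by simp
  qed
  note cd = this
  have "(fresnel_tail has_vector_derivative
      cis (- pi / 4) * (cis (- z\<^sup>2) * (- ?\<kappa> * R) + ((- 2 * \<i> * of_real z) * cis (- z\<^sup>2)) * I)) (at z within {0..})"
    unfolding fresnel_tail_def[abs_def] mult.assoc I_def
    by (intro has_vector_derivative_mult_right has_vector_derivative_mult[OF cd D, unfolded mult.assoc I_def])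
  \<comment> \<open>As \<open>fresnel_rate\<^sup>2 = 4 * \<i>\<close>, the coefficient
    \<open>- 2 * \<i> * z\<close> is \<open>- fresnel_rate\<^sup>2 * z / 2\<close>; pulling out
    \<open>- fresnel_rate / 2\<close> leaves the left-hand side of \<open>parts\<close>.\<close>
  moreover have "cis (- pi / 4) * (cis (- z\<^sup>2) * (- ?\<kappa> * R) + ((- 2 * \<i> * of_real z) * cis (- z\<^sup>2)) * I)
     = - (cis (- pi / 4) * ?\<kappa>) / 2 * cis (- z\<^sup>2) * (2 * R + ?\<kappa> * of_real z * I)"
    using fresnel_rate_square by (simp add: algebra_simps power2_eq_square)
  ultimately show ?thesis
    unfolding parts fresnel_rate_rotate by simp
qed

section \<open>Stationary phase with a singular amplitude\<close>

text \<open>The improper integral of \<open>cis (- t * s\<^sup>2)\<close> over \<open>s \<ge> y\<close>.\<close>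

definition osc_tail :: "real \<Rightarrow> real \<Rightarrow> complex" where
  "osc_tail t y = fresnel_tail (sqrt t * y) /\<^sub>R sqrt t"

lemma norm_osc_tail_0: "t > 0 \<Longrightarrow> norm (osc_tail t 0) = sqrt (pi / t) / 2"
  by (simp add: osc_tail_def norm_fresnel_tail_0 real_sqrt_divide field_simps)

lemma norm_osc_tail_le:
  assumes "t > 0" "y \<ge> 0"
  shows "norm (osc_tail t y) \<le> 2 / (sqrt t * (1 + sqrt t * y))"
proof -
  have "norm (osc_tail t y) = norm (fresnel_tail (sqrt t * y)) / sqrt t"
    using assms by (simp add: osc_tail_def divide_inverse mult.commute)
  also have "\<dots> \<le> 2 / (1 + sqrt t * y) / sqrt t"
    using assms by (intro divide_right_mono norm_fresnel_tail_le) auto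
  also have "\<dots> = 2 / (sqrt t * (1 + sqrt t * y))" by (simp add: mult.commute)
  finally show ?thesis .
qed

lemma norm_osc_tail_le_inverse:
  assumes "t > 0" "y > 0"
  shows "norm (osc_tail t y) \<le> 2 / (t * y)"
proof -
  have "t * y = sqrt t * (sqrt t * y)" using assms by (simp add: real_sqrt_mult_self flip: mult.assoc)
  also have "\<dots> \<le> sqrt t * (1 + sqrt t * y)" using assms by (intro mult_left_mono) auto
  finally have "2 / (sqrt t * (1 + sqrt t * y)) \<le> 2 / (t * y)"
    using assms by (intro divide_left_mono) (auto intro!: mult_pos_pos add_pos_pos)
  then show ?thesis using norm_osc_tail_le[of t y] assms by linarith
qed

lemma osc_tail_has_vector_derivative:
  assumes "t > 0" "y \<ge> 0"
  shows "(osc_tail t has_vector_derivative - cis (- t * y\<^sup>2)) (at y within {0..})"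
proof -
  have "((fresnel_tail \<circ> (\<lambda>y. sqrt t * y)) has_vector_derivative sqrt t *\<^sub>R - cis (- (sqrt t * y)\<^sup>2))
      (at y within {0..})"
  proof (rule vector_diff_chain_within)
    show "((\<lambda>y. sqrt t * y) has_vector_derivative sqrt t) (at y within {0..})"
      by (auto intro!: derivative_eq_intros simp: has_vector_derivative_def)
    show "(fresnel_tail has_vector_derivative - cis (- (sqrt t * y)\<^sup>2)) (at (sqrt t * y) within (\<lambda>y. sqrt t * y) ` {0..})"
      using assms
      by (intro has_vector_derivative_within_subset[OF fresnel_tail_has_vector_derivative]) auto
  qed
  from has_vector_derivative_scaleR[OF DERIV_const[of "inverse (sqrt t)"] this]
  show ?thesis using assms
    by (simp add: osc_tail_def[abs_def] o_def power_mult_distrib)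
qed

section \<open>Integration by parts away from the singular end\<close>

lemma osc_tail_shift_has_vector_derivative:
  assumes "t > 0" "p \<in> {q..d}"
  shows "((\<lambda>p. osc_tail t (p - q)) has_vector_derivative - cis (- t * (p - q)\<^sup>2)) (at p within {q..d})"
proof -
  have "((osc_tail t \<circ> (\<lambda>p. p - q)) has_vector_derivative 1 *\<^sub>R - cis (- t * (p - q)\<^sup>2)) (at p within {q..d})"
  proof (rule vector_diff_chain_within)
    show "((\<lambda>p. p - q) has_vector_derivative 1) (at p within {q..d})"
      by (auto intro!: derivative_eq_intros simp: has_vector_derivative_def)
    show "(osc_tail t has_vector_derivative - cis (- t * (p - q)\<^sup>2)) (at (p - q) within (\<lambda>p. p - q) ` {q..d})"
      using assms by (intro has_vector_derivative_within_subset[OF osc_tail_has_vector_derivative]) auto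
  qed
  then show ?thesis by (simp add: o_def)
qed

lemma continuous_on_osc_tail:
  assumes "t > 0"
  shows "continuous_on {q..d} (\<lambda>p. osc_tail t (p - q))"
  using osc_tail_shift_has_vector_derivative[OF assms] by (intro continuous_on_vector_derivative)

text \<open>Minus the tail is a primitive of the oscillating factor. With the stationary point at
  the left end, the boundary term \<open>F q * osc_tail t 0\<close> is one half of the main
  term.\<close>

lemma oscillatory_integral_by_parts:
  fixes F F' :: "real \<Rightarrow> complex"
  assumes "q \<le> d" "t > 0"
    and F: "\<And>p. p \<in> {q..d} \<Longrightarrow> (F has_vector_derivative F' p) (at p within {q..d})"
    and F': "continuous_on {q..d} F'"
  shows "integral {q..d} (\<lambda>p. F p * cis (- t * (p - q)\<^sup>2)) =
    F q * osc_tail t 0 - F d * osc_tail t (d - q) + integral {q..d} (\<lambda>p. F' p * osc_tail t (p - q))"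
proof -
  have "((\<lambda>p. F p * (- cis (- t * (p - q)\<^sup>2)) + F' p * osc_tail t (p - q)) has_integral
      F d * osc_tail t (d - q) - F q * osc_tail t (q - q)) {q..d}"
    using assms osc_tail_shift_has_vector_derivative
    by (intro fundamental_theorem_of_calculus has_vector_derivative_mult) auto
  moreover have i: "(\<lambda>p. F' p * osc_tail t (p - q)) integrable_on {q..d}"
    by (intro integrable_continuous_real continuous_intros F' continuous_on_osc_tail assms)
  ultimately have "((\<lambda>p. F p * (- cis (- t * (p - q)\<^sup>2))) has_integral
      F d * osc_tail t (d - q) - F q * osc_tail t (q - q) - integral {q..d} (\<lambda>p. F' p * osc_tail t (p - q))) {q..d}"
    using has_integral_diff[OF _ integrable_integral[OF i]] by fastforce
  from integral_unique[OF has_integral_neg[OF this]] show ?thesis by simp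
qed

text \<open>Integrating the bound of \<open>norm_osc_tail_le\<close> gives
  \<open>2 / t * ln (1 + sqrt t * (d - q))\<close>. Because \<open>\<mu> < 1\<close>, the logarithm
  is absorbed by \<open>t powr (1 - \<mu>)\<close>.\<close>

lemma integral_osc_tail_le:
  fixes G :: "real \<Rightarrow> complex"
  assumes "q \<le> d" "d - q \<le> L" "t \<ge> 1" "\<mu> < 1" "K \<ge> 0"
    and G: "continuous_on {q..d} G" "\<And>p. p \<in> {q..d} \<Longrightarrow> norm (G p) \<le> K"
  shows "norm (integral {q..d} (\<lambda>p. G p * osc_tail t (p - q)))
     \<le> K * (2 * ln (1 + L) + 1 / (1 - \<mu>)) * t powr - \<mu>"
proof -
  have t: "t > 0" using assms by simp
  have pos: "1 + sqrt t * (p - q) > 0" if "p \<in> {q..d}" for p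
    using that t by (intro add_pos_nonneg mult_nonneg_nonneg) auto
  have "((\<lambda>p. K * (2 / (sqrt t * (1 + sqrt t * (p - q))))) has_integral
     K * (2 / t * ln (1 + sqrt t * (d - q))) - K * (2 / t * ln (1 + sqrt t * (q - q)))) {q..d}"
  proof (rule fundamental_theorem_of_calculus[OF \<open>q \<le> d\<close>])
    fix p assume p: "p \<in> {q..d}"
    have "((\<lambda>p. K * (2 / t * ln (1 + sqrt t * (p - q)))) has_real_derivative
        K * (2 / t * (sqrt t / (1 + sqrt t * (p - q))))) (at p within {q..d})"
      using pos[OF p] t by (auto intro!: derivative_eq_intros, simp only: mult_ac)
    moreover have "2 / t * (sqrt t / (1 + sqrt t * (p - q))) = 2 / (sqrt t * (1 + sqrt t * (p - q)))"
    proof -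
      have "2 / t * (sqrt t / (1 + sqrt t * (p - q))) = 2 / (sqrt t * sqrt t) * (sqrt t / (1 + sqrt t * (p - q)))"
        using t by simp
      also have "\<dots> = 2 / (sqrt t * (1 + sqrt t * (p - q)))"
        using t pos[OF p] by (simp add: divide_simps del: real_sqrt_mult_self)
      finally show ?thesis .
    qed
    ultimately show "((\<lambda>p. K * (2 / t * ln (1 + sqrt t * (p - q)))) has_vector_derivative
        K * (2 / (sqrt t * (1 + sqrt t * (p - q))))) (at p within {q..d})"
      by (simp only: has_real_derivative_iff_has_vector_derivative)
  qed
  then have J: "((\<lambda>p. K * (2 / (sqrt t * (1 + sqrt t * (p - q))))) has_integral
     K * (2 / t * ln (1 + sqrt t * (d - q)))) {q..d}" by simp
  have "norm (integral {q..d} (\<lambda>p. G p * osc_tail t (p - q))) \<le> integral {q..d} (\<lambda>p. K * (2 / (sqrt t * (1 + sqrt t * (p - q)))))"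
  proof (rule integral_norm_bound_integral)
    show "(\<lambda>p. G p * osc_tail t (p - q)) integrable_on {q..d}"
      by (intro integrable_continuous_real continuous_intros G continuous_on_osc_tail t)
    show "(\<lambda>p. K * (2 / (sqrt t * (1 + sqrt t * (p - q))))) integrable_on {q..d}"
      using J by blast
    show "norm (G p * osc_tail t (p - q)) \<le> K * (2 / (sqrt t * (1 + sqrt t * (p - q))))" if "p \<in> {q..d}" for p
      unfolding norm_mult using that assms t by (intro mult_mono norm_osc_tail_le G) auto
  qed
  also have "\<dots> = K * (2 / t * ln (1 + sqrt t * (d - q)))" using J by (rule integral_unique)
  \<comment> \<open>As \<open>sqrt t \<ge> 1\<close>, the logarithm is at most
    \<open>ln t / 2 + ln (1 + L)\<close>. The bound of \<open>ln t\<close> by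
    \<open>t powr (1 - \<mu>) / (1 - \<mu>)\<close> is the source of the second summand.\<close>
  also have "\<dots> \<le> K * (2 / t * ((ln (1 + L) + 1 / (2 * (1 - \<mu>))) * t powr (1 - \<mu>)))"
  proof -
    have L: "L \<ge> 0" using assms by linarith
    have st: "sqrt t \<ge> 1" using assms by simp
    have "1 + sqrt t * (d - q) \<le> sqrt t * (1 + L)"
      using st mult_left_mono[OF \<open>d - q \<le> L\<close>, of "sqrt t"] unfolding distrib_left by linarith
    then have "ln (1 + sqrt t * (d - q)) \<le> ln (sqrt t * (1 + L))"
      using pos[of d] assms by (intro ln_mono) auto
    also have "\<dots> = ln t / 2 + ln (1 + L)"
      using t L by (simp add: ln_mult ln_sqrt)
    also have "\<dots> \<le> t powr (1 - \<mu>) / (1 - \<mu>) / 2 + ln (1 + L) * t powr (1 - \<mu>)"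
      using ln_powr_bound[of t "1 - \<mu>"] assms L ge_one_powr_ge_zero[of t "1 - \<mu>"]
      by (intro add_mono divide_right_mono mult_le_cancel_left1[THEN iffD2]) auto
    also have "\<dots> = (ln (1 + L) + 1 / (2 * (1 - \<mu>))) * t powr (1 - \<mu>)"
      using assms by (simp add: field_simps)
    finally show ?thesis using assms t by (intro mult_left_mono) auto
  qed
  also have "t powr (1 - \<mu>) = t * t powr - \<mu>" using t by (simp add: powr_diff powr_minus field_simps)
  also have "K * (2 / t * ((ln (1 + L) + 1 / (2 * (1 - \<mu>))) * (t * t powr - \<mu>)))
      = K * (2 * (ln (1 + L) + 1 / (2 * (1 - \<mu>)))) * t powr - \<mu>"
    using t by simp
  also have "2 * (ln (1 + L) + 1 / (2 * (1 - \<mu>))) = 2 * ln (1 + L) + 1 / (1 - \<mu>)"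
    using \<open>\<mu> < 1\<close> by (simp add: field_simps)
  finally show ?thesis .
qed

section \<open>Approaching the singularity of the amplitude\<close>

lemma has_integral_powr_singular_end:
  fixes D \<nu> :: real
  assumes "a \<le> b" "b < D" "\<nu> \<noteq> 0"
  shows "((\<lambda>p. (D - p) powr (\<nu> - 1)) has_integral ((D - a) powr \<nu> - (D - b) powr \<nu>) / \<nu>) {a..b}"
proof -
  have "((\<lambda>p. (D - p) powr (\<nu> - 1)) has_integral (- ((D - b) powr \<nu>) / \<nu>) - (- ((D - a) powr \<nu>) / \<nu>)) {a..b}"
  proof (rule fundamental_theorem_of_calculus[OF \<open>a \<le> b\<close>])
    fix p assume "p \<in> {a..b}"
    then have "((\<lambda>p. - ((D - p) powr \<nu>) / \<nu>) has_real_derivative (D - p) powr (\<nu> - 1)) (at p within {a..b})"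
      using assms by (auto intro!: derivative_eq_intros)
    then show "((\<lambda>p. - ((D - p) powr \<nu>) / \<nu>) has_vector_derivative (D - p) powr (\<nu> - 1)) (at p within {a..b})"
      by (simp add: has_real_derivative_iff_has_vector_derivative)
  qed
  moreover have "(- ((D - b) powr \<nu>) / \<nu>) - (- ((D - a) powr \<nu>) / \<nu>) = ((D - a) powr \<nu> - (D - b) powr \<nu>) / \<nu>"
    by (simp add: diff_divide_distrib)
  ultimately show ?thesis by simp
qed

text \<open>The singularity \<open>D\<close> lies to the right of \<open>q\<close>, as integration
  by parts from \<open>q\<close> requires. Up to distance \<delta> from \<open>D\<close> the
  derivative \<open>F'\<close> is bounded. From there to distance \<open>\<delta> / t\<close> the
  tail is at most \<open>2 / (t * \<delta>)\<close>, while \<open>F'\<close> has an integral of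
  order \<open>(\<delta> / t) powr (\<mu> - 1)\<close>. The boundary term at the stopping point has
  the same order, and the product is of order \<open>t powr - \<mu>\<close>.\<close>

lemma singular_end_estimate:
  fixes F F' :: "real \<Rightarrow> complex"
  assumes \<mu>: "\<mu> < 1" and "\<delta> > 0" "q \<le> D - 2 * \<delta>" "D - q \<le> L" "t \<ge> 1" "K \<ge> 0"
    and F: "\<And>p. p \<in> {q..<D} \<Longrightarrow> (F has_vector_derivative F' p) (at p within {q..<D})"
    and F': "continuous_on {q..<D} F'"
    and bF: "\<And>p. p \<in> {q..<D} \<Longrightarrow> norm (F p) \<le> K * (D - p) powr (\<mu> - 1)"
    and bF': "\<And>p. p \<in> {q..<D} \<Longrightarrow> norm (F' p) \<le> K * (D - p) powr (\<mu> - 2)"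
  shows "norm (integral {q..D - \<delta> / t} (\<lambda>p. F p * cis (- t * (p - q)\<^sup>2)) - F q * osc_tail t 0)
    \<le> K * \<delta> powr (\<mu> - 2) * (2 + 3 / (1 - \<mu>) + 2 * ln (1 + L)) * t powr - \<mu>"
proof -
  \<comment> \<open>\<open>m\<close> separates bounded from singular \<open>F'\<close>, and
    \<open>d\<close> is the stopping point. From \<open>q \<le> D - 2 * \<delta>\<close> the tail is
    only met at arguments at least \<delta> beyond \<open>m\<close>.\<close>
  define m where "m = D - \<delta>"
  define d where "d = D - \<delta> / t"
  have t: "t > 0" using assms by simp
  have dt: "\<delta> / t \<le> \<delta>" "\<delta> / t > 0"
    using assms divide_left_mono[of 1 t \<delta>] by auto
  have ord: "q + \<delta> \<le> m" "m \<le> d" "d < D" "q < d" "q < m"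
    using assms dt by (auto simp: m_def d_def)
  have sub: "{q..d} \<subseteq> {q..<D}" using ord by auto
  \<comment> \<open>This power count serves both the boundary term at \<open>d\<close> and the
    integral over \<open>{m..d}\<close>.\<close>
  have scale: "(\<delta> / t) powr (\<mu> - 1) * (2 / (t * \<delta>)) = 2 * \<delta> powr (\<mu> - 2) * t powr - \<mu>"
  proof -
    have 1: "t * t powr (\<mu> - 1) = t powr \<mu>" using t by (simp add: powr_mult_base)
    have 2: "\<delta> powr (\<mu> - 1) = \<delta> * \<delta> powr (\<mu> - 2)"
      using powr_mult_base[of \<delta> "\<mu> - 2"] assms by simp
    have "(\<delta> / t) powr (\<mu> - 1) * (2 / (t * \<delta>)) = 2 * (\<delta> powr (\<mu> - 1) / \<delta>) / (t * t powr (\<mu> - 1))"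
      using t by (simp add: powr_divide ac_simps)
    also have "\<dots> = 2 * \<delta> powr (\<mu> - 2) / t powr \<mu>"
      unfolding 1 2 using assms by simp
    finally show ?thesis by (simp add: powr_minus divide_inverse)
  qed
  let ?G = "\<lambda>p. F' p * osc_tail t (p - q)"
  have Gint: "?G integrable_on {q..d}"
    by (intro integrable_continuous_real continuous_intros continuous_on_osc_tail t continuous_on_subset[OF F' sub])
  have parts: "integral {q..d} (\<lambda>p. F p * cis (- t * (p - q)\<^sup>2)) - F q * osc_tail t 0 =
    - (F d * osc_tail t (d - q)) + (integral {q..m} ?G + integral {m..d} ?G)"
  proof -
    have "integral {q..d} (\<lambda>p. F p * cis (- t * (p - q)\<^sup>2)) =
        F q * osc_tail t 0 - F d * osc_tail t (d - q) + integral {q..d} ?G"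
      using ord t sub
      by (intro oscillatory_integral_by_parts continuous_on_subset[OF F'])
        (auto intro: has_vector_derivative_within_subset[OF F])
    moreover have "integral {q..d} ?G = integral {q..m} ?G + integral {m..d} ?G"
      using ord by (intro Henstock_Kurzweil_Integration.integral_combine[symmetric] Gint) auto
    ultimately show ?thesis by simp
  qed
  have tail: "norm (osc_tail t (p - q)) \<le> 2 / (t * \<delta>)" if "p \<ge> m" for p
  proof -
    have "norm (osc_tail t (p - q)) \<le> 2 / (t * (p - q))"
      using that ord t assms by (intro norm_osc_tail_le_inverse) auto
    also have "\<dots> \<le> 2 / (t * \<delta>)"
      using that ord t assms by (intro divide_left_mono mult_left_mono mult_pos_pos) auto
    finally show ?thesis .
  qed
  have Dd: "D - d = \<delta> / t" by (simp add: d_def)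
  have e1: "norm (F d * osc_tail t (d - q)) \<le> K * (2 * \<delta> powr (\<mu> - 2) * t powr - \<mu>)"
  proof -
    have "norm (F d * osc_tail t (d - q)) \<le> (K * (D - d) powr (\<mu> - 1)) * (2 / (t * \<delta>))"
      unfolding norm_mult using ord assms by (intro mult_mono bF tail) auto
    also have "\<dots> = K * ((\<delta> / t) powr (\<mu> - 1) * (2 / (t * \<delta>)))" by (simp add: Dd)
    finally show ?thesis unfolding scale .
  qed
  have e2: "norm (integral {q..m} ?G) \<le> K * \<delta> powr (\<mu> - 2) * (2 * ln (1 + L) + 1 / (1 - \<mu>)) * t powr - \<mu>"
  proof (rule integral_osc_tail_le)
    show "continuous_on {q..m} F'" using ord by (intro continuous_on_subset[OF F']) auto
    fix p assume p: "p \<in> {q..m}"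
    then have "norm (F' p) \<le> K * (D - p) powr (\<mu> - 2)" using ord by (intro bF') auto
    also have "\<dots> \<le> K * \<delta> powr (\<mu> - 2)"
      using p assms by (intro mult_left_mono powr_mono2') (auto simp: m_def)
    finally show "norm (F' p) \<le> K * \<delta> powr (\<mu> - 2)" .
  qed (use assms ord in auto)
  have e3: "norm (integral {m..d} ?G) \<le> K * (2 * \<delta> powr (\<mu> - 2) * t powr - \<mu>) / (1 - \<mu>)"
  proof -
    have I: "((\<lambda>p. K * (D - p) powr (\<mu> - 2) * (2 / (t * \<delta>))) has_integral
        K * (((D - m) powr (\<mu> - 1) - (D - d) powr (\<mu> - 1)) / (\<mu> - 1)) * (2 / (t * \<delta>))) {m..d}"
      using has_integral_powr_singular_end[of m d D "\<mu> - 1"] ord \<mu>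
      by (intro has_integral_mult_left has_integral_mult_right) simp
    have "norm (integral {m..d} ?G) \<le> integral {m..d} (\<lambda>p. K * (D - p) powr (\<mu> - 2) * (2 / (t * \<delta>)))"
    proof (rule integral_norm_bound_integral)
      show "?G integrable_on {m..d}"
        using ord by (intro integrable_subinterval_real[OF Gint]) auto
      show "(\<lambda>p. K * (D - p) powr (\<mu> - 2) * (2 / (t * \<delta>))) integrable_on {m..d}"
        using I by blast
      show "norm (?G p) \<le> K * (D - p) powr (\<mu> - 2) * (2 / (t * \<delta>))" if "p \<in> {m..d}" for p
        unfolding norm_mult using that ord assms by (intro mult_mono bF' tail) auto
    qed
    \<comment> \<open>As \<open>\<mu> - 1\<close> is negative, both signs are reversed. The power of
      \<open>D - m\<close> is then dropped, and that of \<open>D - d = \<delta> / t\<close>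
      remains.\<close>
    also have "\<dots> = K * (((D - d) powr (\<mu> - 1) - (D - m) powr (\<mu> - 1)) / (1 - \<mu>)) * (2 / (t * \<delta>))"
      unfolding integral_unique[OF I] by (metis minus_diff_eq minus_divide_divide)
    also have "\<dots> \<le> K * ((D - d) powr (\<mu> - 1) / (1 - \<mu>)) * (2 / (t * \<delta>))"
      using assms t by (intro mult_right_mono mult_left_mono divide_right_mono) auto
    also have "\<dots> = K * ((\<delta> / t) powr (\<mu> - 1) * (2 / (t * \<delta>))) / (1 - \<mu>)" by (simp add: Dd mult_ac)
    finally show ?thesis unfolding scale .
  qed
  have "norm (integral {q..d} (\<lambda>p. F p * cis (- t * (p - q)\<^sup>2)) - F q * osc_tail t 0)
     \<le> norm (F d * osc_tail t (d - q)) + (norm (integral {q..m} ?G) + norm (integral {m..d} ?G))"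
    unfolding parts by (intro order_trans[OF norm_triangle_ineq] add_mono) simp_all
  also have "\<dots> \<le> K * (2 * \<delta> powr (\<mu> - 2) * t powr - \<mu>) +
      (K * \<delta> powr (\<mu> - 2) * (2 * ln (1 + L) + 1 / (1 - \<mu>)) * t powr - \<mu> +
       K * (2 * \<delta> powr (\<mu> - 2) * t powr - \<mu>) / (1 - \<mu>))"
    by (intro add_mono e1 e2 e3)
  also have "\<dots> = K * \<delta> powr (\<mu> - 2) * t powr - \<mu> * (2 + (2 * ln (1 + L) + 1 / (1 - \<mu>)) + 2 / (1 - \<mu>))"
    by (simp add: distrib_left mult_ac)
  also have "2 + (2 * ln (1 + L) + 1 / (1 - \<mu>)) + 2 / (1 - \<mu>) = 2 + 3 / (1 - \<mu>) + 2 * ln (1 + L)"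
    by (simp add: add_divide_distrib flip: add_divide_distrib)
  finally show ?thesis unfolding d_def by (simp add: mult_ac)
qed

section \<open>Assembly of the stationary phase estimate\<close>

lemma absolutely_integrable_mult_cis:
  fixes F :: "real \<Rightarrow> complex"
  assumes F: "F absolutely_integrable_on S" and h: "continuous_on UNIV h"
  shows "(\<lambda>p. F p * cis (h p)) absolutely_integrable_on S"
  unfolding set_integrable_def
proof (rule Bochner_Integration.integrable_bound)
  have m: "(\<lambda>p. indicator S p *\<^sub>R F p) \<in> borel_measurable lebesgue"
    using F by (auto simp: set_integrable_def)
  have "(\<lambda>p. cis (h p)) \<in> borel_measurable lebesgue"
    using h by (intro measurable_completion, unfold measurable_lborel2)
      (intro borel_measurable_continuous_onI continuous_intros)
  then have "(\<lambda>p. (indicator S p *\<^sub>R F p) * cis (h p)) \<in> borel_measurable lebesgue"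
    by (rule borel_measurable_times[OF m])
  then show "(\<lambda>p. indicator S p *\<^sub>R (F p * cis (h p))) \<in> borel_measurable lebesgue" by simp
  show "integrable lebesgue (\<lambda>p. indicator S p *\<^sub>R F p)"
    using F by (simp add: set_integrable_def)
qed (simp add: norm_mult)

text \<open>The integral is cut at \<open>c = p1 + \<delta> / t\<close> and at \<open>q\<close>. The
  piece next to \<open>p1\<close> is small by size alone; each of the other two contributes
  \<open>F q * osc_tail t 0\<close>, hence the factor 2. The constant does not involve
  \<open>q\<close>, so the estimate is uniform.\<close>

lemma singular_stationary_phase:
  fixes F F' :: "real \<Rightarrow> complex"
  assumes \<mu>: "0 < \<mu>" "\<mu> < 1" and "\<delta> > 0" "K \<ge> 0" "t \<ge> 1" and q: "p1 + 2 * \<delta> \<le> q" "q \<le> p2"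
    and int: "F absolutely_integrable_on {p1..p2}"
    and F: "\<And>p. p \<in> {p1<..p2} \<Longrightarrow> (F has_vector_derivative F' p) (at p within {p1<..p2})"
    and F': "continuous_on {p1<..p2} F'"
    and bF: "\<And>p. p \<in> {p1..p2} \<Longrightarrow> norm (F p) \<le> K * (p - p1) powr (\<mu> - 1)"
    and bF': "\<And>p. p \<in> {p1<..p2} \<Longrightarrow> norm (F' p) \<le> K * (p - p1) powr (\<mu> - 2)"
    and "F p2 = 0"
  shows "norm (integral {p1..p2} (\<lambda>p. F p * cis (- t * (p - q)\<^sup>2)) - 2 * F q * osc_tail t 0)
    \<le> (K * \<delta> powr \<mu> / \<mu> + K * \<delta> powr (\<mu> - 2) * (2 + 4 / (1 - \<mu>) + 4 * ln (1 + (p2 - p1)))) * t powr - \<mu>"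
proof -
  let ?f = "\<lambda>p. F p * cis (- t * (p - q)\<^sup>2)"
  define c where "c = p1 + \<delta> / t"
  define L where "L = p2 - p1"
  have t: "t > 0" using assms by simp
  have dt: "\<delta> / t \<le> \<delta>" "\<delta> / t > 0"
    using assms divide_left_mono[of 1 t \<delta>] by auto
  have ord: "p1 < c" "c < q" "p1 < q" using dt q assms by (auto simp: c_def)
  have fint: "?f integrable_on {p1..p2}"
    by (intro set_lebesgue_integral_eq_integral(1) absolutely_integrable_mult_cis int continuous_intros)
  have split: "integral {p1..p2} ?f = integral {p1..c} ?f + (integral {c..q} ?f + integral {q..p2} ?f)"
  proof -
    have "integral {p1..p2} ?f = integral {p1..c} ?f + integral {c..p2} ?f"
      using Henstock_Kurzweil_Integration.integral_combine[OF _ _ fint, of c] ord q by simp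
    also have "integral {c..p2} ?f = integral {c..q} ?f + integral {q..p2} ?f"
      using Henstock_Kurzweil_Integration.integral_combine[of c q p2 ?f] integrable_subinterval_real[OF fint, of c p2] ord q by simp
    finally show ?thesis .
  qed
  have e1: "norm (integral {p1..c} ?f) \<le> K * \<delta> powr \<mu> / \<mu> * t powr - \<mu>"
  proof -
    \<comment> \<open>The primitive is continuous at \<open>p1\<close> because
      \<open>\<mu> > 0\<close>, but the integrand blows up there, so derivatives are only taken in
      the interior.\<close>
    have I: "((\<lambda>p. (p - p1) powr (\<mu> - 1)) has_integral (c - p1) powr \<mu> / \<mu> - (p1 - p1) powr \<mu> / \<mu>) {p1..c}"
    proof (rule fundamental_theorem_of_calculus_interior)
      show "continuous_on {p1..c} (\<lambda>p. (p - p1) powr \<mu> / \<mu>)"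
        using \<mu> by (intro continuous_intros continuous_on_powr') auto
      fix p assume "p \<in> {p1<..<c}"
      then have "((\<lambda>p. (p - p1) powr \<mu> / \<mu>) has_real_derivative (p - p1) powr (\<mu> - 1)) (at p)"
        using \<mu> by (auto intro!: derivative_eq_intros)
      then show "((\<lambda>p. (p - p1) powr \<mu> / \<mu>) has_vector_derivative (p - p1) powr (\<mu> - 1)) (at p)"
        by (simp add: has_real_derivative_iff_has_vector_derivative)
    qed (use ord in auto)
    have "norm (integral {p1..c} ?f) \<le> integral {p1..c} (\<lambda>p. K * (p - p1) powr (\<mu> - 1))"
    proof (rule integral_norm_bound_integral)
      show "?f integrable_on {p1..c}" using ord q by (intro integrable_subinterval_real[OF fint]) auto
      show "(\<lambda>p. K * (p - p1) powr (\<mu> - 1)) integrable_on {p1..c}" using has_integral_mult_right[OF I] by blast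
      show "norm (?f p) \<le> K * (p - p1) powr (\<mu> - 1)" if "p \<in> {p1..c}" for p
        using bF[of p] that ord q by (simp add: norm_mult)
    qed
    also have "\<dots> = K * ((\<delta> / t) powr \<mu> / \<mu>)"
      using integral_unique[OF has_integral_mult_right[OF I, of K]] \<mu> by (simp add: c_def)
    also have "(\<delta> / t) powr \<mu> = \<delta> powr \<mu> * t powr - \<mu>"
      using t assms by (simp add: powr_divide powr_minus_divide)
    also have "K * (\<delta> powr \<mu> * t powr - \<mu> / \<mu>) = K * \<delta> powr \<mu> / \<mu> * t powr - \<mu>"
      by simp
    finally show ?thesis .
  qed
  \<comment> \<open>The reflection of \<open>p\<close> to \<open>- p\<close> moves the singular end
    to the right of the stationary point: \<open>D\<close> becomes \<open>- p1\<close> and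
    \<open>q\<close> becomes \<open>- q\<close>.\<close>
  have e2: "norm (integral {c..q} ?f - F q * osc_tail t 0)
      \<le> K * \<delta> powr (\<mu> - 2) * (2 + 3 / (1 - \<mu>) + 2 * ln (1 + L)) * t powr - \<mu>"
  proof -
    have D: "((\<lambda>p. F (- p)) has_vector_derivative - F' (- p)) (at p within {- q..<- p1})"
      if p: "p \<in> {- q..<- p1}" for p
    proof -
      have "((F \<circ> uminus) has_vector_derivative - 1 *\<^sub>R F' (- p)) (at p within {- q..<- p1})"
      proof (rule vector_diff_chain_within)
        show "(uminus has_vector_derivative - 1) (at p within {- q..<- p1})"
          by (auto intro!: derivative_eq_intros simp: has_vector_derivative_def)
        show "(F has_vector_derivative F' (- p)) (at (- p) within uminus ` {- q..<- p1})"
          using p q by (intro has_vector_derivative_within_subset[OF F]) auto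
      qed
      then show ?thesis by (simp add: o_def)
    qed
    have "norm (integral {- q..- p1 - \<delta> / t} (\<lambda>p. F (- p) * cis (- t * (p - (- q))\<^sup>2)) - F (- (- q)) * osc_tail t 0)
      \<le> K * \<delta> powr (\<mu> - 2) * (2 + 3 / (1 - \<mu>) + 2 * ln (1 + L)) * t powr - \<mu>"
    proof (rule singular_end_estimate[OF _ _ _ _ _ _ D])
      show "continuous_on {- q..<- p1} (\<lambda>p. - F' (- p))"
        using q by (intro continuous_intros continuous_on_compose2[OF F']) auto
      show "norm (F (- p)) \<le> K * (- p1 - p) powr (\<mu> - 1)" if "p \<in> {- q..<- p1}" for p
        using bF[of "- p"] that q by (simp add: minus_diff_commute)
      show "norm (- F' (- p)) \<le> K * (- p1 - p) powr (\<mu> - 2)" if "p \<in> {- q..<- p1}" for p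
        using bF'[of "- p"] that q by (simp add: minus_diff_commute)
    qed (use assms in \<open>auto simp: L_def\<close>)
    also have "integral {- q..- p1 - \<delta> / t} (\<lambda>p. F (- p) * cis (- t * (p - (- q))\<^sup>2)) = integral {c..q} ?f"
    proof -
      have eq: "F (- p) * cis (- t * (p - (- q))\<^sup>2) = ?f (- p)" for p
        by (simp add: power2_eq_square algebra_simps)
      show ?thesis unfolding eq
        using Henstock_Kurzweil_Integration.integral_reflect_real[of q c ?f] by (simp add: c_def)
    qed
    finally show ?thesis by simp
  qed
  have e3: "norm (integral {q..p2} ?f - F q * osc_tail t 0)
      \<le> K * \<delta> powr (\<mu> - 2) * (2 * ln (1 + L) + 1 / (1 - \<mu>)) * t powr - \<mu>"
  proof -
    have "integral {q..p2} ?f = F q * osc_tail t 0 - F p2 * osc_tail t (p2 - q)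
        + integral {q..p2} (\<lambda>p. F' p * osc_tail t (p - q))"
      using ord q t by (intro oscillatory_integral_by_parts continuous_on_subset[OF F'])
        (auto intro: has_vector_derivative_within_subset[OF F])
    \<comment> \<open>The boundary term vanishes with \<open>F p2\<close>, which keeps the bound
      uniform up to \<open>q = p2\<close>.\<close>
    then have eq: "integral {q..p2} ?f - F q * osc_tail t 0 = integral {q..p2} (\<lambda>p. F' p * osc_tail t (p - q))"
      using \<open>F p2 = 0\<close> by simp
    show ?thesis unfolding eq
    proof (rule integral_osc_tail_le)
      show "continuous_on {q..p2} F'" using ord by (intro continuous_on_subset[OF F']) auto
      fix p assume p: "p \<in> {q..p2}"
      then have "norm (F' p) \<le> K * (p - p1) powr (\<mu> - 2)" using ord by (intro bF') auto
      also have "\<dots> \<le> K * \<delta> powr (\<mu> - 2)"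
        using p assms by (intro mult_left_mono powr_mono2') auto
      finally show "norm (F' p) \<le> K * \<delta> powr (\<mu> - 2)" .
    qed (use assms ord in \<open>auto simp: L_def\<close>)
  qed
  have collect: "x * w + (y * v * w + y * z * w) = (x + y * (v + z)) * w" for v w x y z :: real
    by (simp add: algebra_simps)
  have decomposition: "integral {p1..p2} ?f - 2 * F q * osc_tail t 0 =
      integral {p1..c} ?f + ((integral {c..q} ?f - F q * osc_tail t 0) + (integral {q..p2} ?f - F q * osc_tail t 0))"
    unfolding split by simp
  have "norm (integral {p1..p2} ?f - 2 * F q * osc_tail t 0) \<le> norm (integral {p1..c} ?f) + (norm (integral {c..q} ?f - F q * osc_tail t 0) +
      norm (integral {q..p2} ?f - F q * osc_tail t 0))"
    unfolding decomposition by (intro order_trans[OF norm_triangle_ineq] add_mono) simp_all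
  also have "\<dots> \<le> K * \<delta> powr \<mu> / \<mu> * t powr - \<mu> +
     (K * \<delta> powr (\<mu> - 2) * (2 + 3 / (1 - \<mu>) + 2 * ln (1 + L)) * t powr - \<mu> +
      K * \<delta> powr (\<mu> - 2) * (2 * ln (1 + L) + 1 / (1 - \<mu>)) * t powr - \<mu>)"
    by (rule add_mono[OF e1 add_mono[OF e2 e3]])
  also have "\<dots> = (K * \<delta> powr \<mu> / \<mu> + K * \<delta> powr (\<mu> - 2) *
      ((2 + 3 / (1 - \<mu>) + 2 * ln (1 + L)) + (2 * ln (1 + L) + 1 / (1 - \<mu>)))) * t powr - \<mu>"
    by (rule collect)
  also have "(2 + 3 / (1 - \<mu>) + 2 * ln (1 + L)) + (2 * ln (1 + L) + 1 / (1 - \<mu>)) = 2 + 4 / (1 - \<mu>) + 4 * ln (1 + L)"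
    by simp
  finally show ?thesis unfolding L_def .
qed

section \<open>Norms of the solution\<close>

lemma L2_norm_on_continuous:
  fixes f :: "real \<Rightarrow> complex"
  assumes "continuous_on {a..b} f"
  shows "L2_norm_on {a..b} f = sqrt (integral {a..b} (\<lambda>x. (norm (f x))\<^sup>2))"
    and "L2_norm_on {a<..<b} f = sqrt (integral {a..b} (\<lambda>x. (norm (f x))\<^sup>2))"
proof -
  have i: "(\<lambda>x. (norm (f x))\<^sup>2) absolutely_integrable_on {a..b}"
    by (intro absolutely_integrable_continuous_real continuous_intros assms)
  show "L2_norm_on {a..b} f = sqrt (integral {a..b} (\<lambda>x. (norm (f x))\<^sup>2))"
    unfolding L2_norm_on_def by (simp add: set_lebesgue_integral_eq_integral(2)[OF i])
  have "(\<lambda>x. (norm (f x))\<^sup>2) absolutely_integrable_on {a<..<b}"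
    by (rule set_integrable_subset[OF i]) auto
  from set_lebesgue_integral_eq_integral(2)[OF this]
  show "L2_norm_on {a<..<b} f = sqrt (integral {a..b} (\<lambda>x. (norm (f x))\<^sup>2))"
    unfolding L2_norm_on_def by (simp add: integral_open_interval_real)
qed

text \<open>This is Minkowski's inequality for \<open>g\<close> and the constant \<open>e\<close>,
  in a one-sided form that is applied in both directions to turn a pointwise error into an error of
  norms.\<close>

lemma sqrt_integral_power2_le:
  fixes f g :: "real \<Rightarrow> real"
  assumes "a < b" and f: "continuous_on {a..b} f" and g: "continuous_on {a..b} g"
    and pos: "\<And>x. x \<in> {a..b} \<Longrightarrow> 0 \<le> f x" and "e \<ge> 0"
    and le: "\<And>x. x \<in> {a..b} \<Longrightarrow> f x \<le> g x + e"
  shows "sqrt (integral {a..b} (\<lambda>x. (f x)\<^sup>2)) \<le> sqrt (integral {a..b} (\<lambda>x. (g x)\<^sup>2)) + e * sqrt (b - a)"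
proof -
  define A where "A = integral {a..b} (\<lambda>x. (g x)\<^sup>2)"
  define m where "m = integral {a..b} g"
  define l where "l = b - a"
  have l: "l > 0" using assms by (simp add: l_def)
  have ig: "(g has_integral m) {a..b}"
    unfolding m_def by (intro integrable_integral integrable_continuous_real g)
  have ig2: "((\<lambda>x. (g x)\<^sup>2) has_integral A) {a..b}"
    unfolding A_def by (intro integrable_integral integrable_continuous_real continuous_intros g)
  have ic: "((\<lambda>x. c) has_integral c * l) {a..b}" for c :: real
    using has_integral_const_real[of c a b] assms by (simp add: l_def mult.commute)
  have sq: "((\<lambda>x. (g x + c)\<^sup>2) has_integral A + 2 * c * m + c\<^sup>2 * l) {a..b}" for c
    using has_integral_add[OF has_integral_add[OF ig2 has_integral_mult_right[OF ig, of "2 * c"]] ic[of "c\<^sup>2"]]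
    by (simp add: power2_sum algebra_simps)
  have A: "A \<ge> 0" using ig2 by (rule has_integral_nonneg) simp
  \<comment> \<open>Cauchy-Schwarz for \<open>g\<close> and 1: \<open>- m / l\<close> minimises the
    nonnegative quadratic in \<open>c\<close> given by \<open>sq\<close>.\<close>
  have "0 \<le> A + 2 * (- m / l) * m + (- m / l)\<^sup>2 * l"
    using sq[of "- m / l"] by (rule has_integral_nonneg) simp
  also have "\<dots> = A - m\<^sup>2 / l" using l by (simp add: field_simps power2_eq_square)
  finally have "m\<^sup>2 \<le> A * l" using l by (simp add: field_simps)
  then have m: "m \<le> sqrt A * sqrt l" using real_le_rsqrt[of m "A * l"] by (simp add: real_sqrt_mult)
  have "integral {a..b} (\<lambda>x. (f x)\<^sup>2) \<le> integral {a..b} (\<lambda>x. (g x + e)\<^sup>2)"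
    using le pos
    by (intro integral_le integrable_continuous_real continuous_intros f g power_mono) auto
  also have "\<dots> = A + 2 * e * m + e\<^sup>2 * l" by (rule integral_unique[OF sq])
  also have "\<dots> \<le> A + 2 * e * (sqrt A * sqrt l) + e\<^sup>2 * l"
    using m \<open>e \<ge> 0\<close> by (simp add: mult_left_mono)
  also have "\<dots> = (sqrt A + e * sqrt l)\<^sup>2"
    using A l by (simp add: power2_sum power_mult_distrib)
  finally have "sqrt (integral {a..b} (\<lambda>x. (f x)\<^sup>2)) \<le> sqrt A + e * sqrt l"
    using A l \<open>e \<ge> 0\<close> by (intro real_le_lsqrt) auto
  then show ?thesis by (simp add: A_def l_def)
qed

text \<open>The inequality \<open>norm z \<le> 1 + (norm z)\<^sup>2\<close> supplies an integrable
  majorant on a bounded interval.\<close>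

lemma square_integrable_imp_absolutely_integrable:
  fixes f :: "real \<Rightarrow> complex"
  assumes "square_integrable f"
  shows "f absolutely_integrable_on {a..b}"
  unfolding set_integrable_def
proof (rule Bochner_Integration.integrable_bound)
  have f: "f \<in> borel_measurable lebesgue" and i: "integrable lebesgue (\<lambda>x. (norm (f x))\<^sup>2)"
    using assms by (auto simp: square_integrable_def)
  show "integrable lebesgue (\<lambda>x. indicator {a..b} x + (norm (f x))\<^sup>2)"
    by (intro Bochner_Integration.integrable_add i) (auto simp: integrable_indicator_iff emeasure_lborel_Icc_eq)
  show "(\<lambda>x. indicator {a..b} x *\<^sub>R f x) \<in> borel_measurable lebesgue"
    using f by (intro borel_measurable_scaleR borel_measurable_indicator) auto
  have "norm z \<le> 1 + (norm z)\<^sup>2" for z :: complex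
  proof -
    have "0 \<le> (norm z - 1)\<^sup>2" by simp
    then have "2 * norm z \<le> 1 + (norm z)\<^sup>2" by (simp add: power2_diff)
    then show ?thesis using norm_ge_zero[of z] by linarith
  qed
  then show "AE x in lebesgue. norm (indicator {a..b} x *\<^sub>R f x) \<le> norm (indicator {a..b} x + (norm (f x))\<^sup>2)"
    by (auto simp: indicator_def)
qed

section \<open>The solution and its singular datum\<close>

lemma norm_schrodinger_solution:
  assumes F: "F absolutely_integrable_on {p1..p2}" and "t > 0"
  shows "norm (schrodinger_solution p1 p2 F t x) =
    norm (integral {p1..p2} (\<lambda>p. F p * cis (- t * (p - x / (2 * t))\<^sup>2))) / (2 * pi)"
proof -
  define q where "q = x / (2 * t)"
  have x: "x = 2 * t * q" using \<open>t > 0\<close> by (simp add: q_def)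
  \<comment> \<open>Completing the square leaves the factor \<open>cis (t * q\<^sup>2)\<close>,
    which has modulus 1 and does not depend on \<open>p\<close>.\<close>
  have e: "F p * exp (- \<i> * of_real (t * p\<^sup>2) + \<i> * of_real (x * p)) =
     cis (t * q\<^sup>2) * (F p * cis (- t * (p - q)\<^sup>2))" for p
  proof -
    have "- \<i> * of_real (t * p\<^sup>2) + \<i> * of_real (x * p) = \<i> * of_real (t * q\<^sup>2) + \<i> * of_real (- t * (p - q)\<^sup>2)"
      unfolding x by (simp add: power2_diff algebra_simps)
    then show ?thesis by (simp only: exp_add cis_conv_exp mult_ac)
  qed
  have i: "(\<lambda>p. F p * cis (- t * (p - q)\<^sup>2)) absolutely_integrable_on {p1..p2}"
    by (intro absolutely_integrable_mult_cis F continuous_intros)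
  have "(LINT p:{p1..p2}|lebesgue. F p * exp (- \<i> * of_real (t * p\<^sup>2) + \<i> * of_real (x * p)))
     = cis (t * q\<^sup>2) * integral {p1..p2} (\<lambda>p. F p * cis (- t * (p - q)\<^sup>2))"
    unfolding e set_integral_mult_right set_lebesgue_integral_eq_integral(2)[OF i] ..
  then show ?thesis
    unfolding schrodinger_solution_def q_def[symmetric]
    by (simp add: norm_mult norm_divide)
qed

lemma continuous_on_schrodinger_solution:
  assumes "F absolutely_integrable_on {p1..p2}"
  shows "continuous_on S (schrodinger_solution p1 p2 F t)"
  using assms
proof (rule schrodinger_solution_solves)
  fix ux :: "real \<Rightarrow> real \<Rightarrow> complex"
  assume "\<And>t x. ((\<lambda>y. schrodinger_solution p1 p2 F t y) has_vector_derivative ux t x) (at x)"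
  then show ?thesis
    by (intro continuous_at_imp_continuous_on ballI has_vector_derivative_continuous) blast
qed

text \<open>The product rule gives one term with each of the exponents \<open>\<mu> - 1\<close> and
  \<open>\<mu> - 2\<close>; on a bounded interval the former is dominated by the latter. At
  \<open>p1\<close> itself the bound on \<open>F\<close> holds as
  \<open>0 powr (\<mu> - 1) = 0\<close>.\<close>

lemma singular_density_bounds:
  fixes util :: "real \<Rightarrow> complex"
  assumes \<mu>: "0 < \<mu>" "\<mu> < 1" and "p1 < p2" and C1: "C1_on {p1..p2} util"
    and F_def: "F = (\<lambda>p. of_real ((p - p1) powr (\<mu> - 1)) * util p)"
  obtains F' :: "real \<Rightarrow> complex" and K :: real
  where "K \<ge> 0" and "continuous_on {p1<..p2} F'"
    and "\<And>p. p \<in> {p1<..p2} \<Longrightarrow> (F has_vector_derivative F' p) (at p within {p1<..p2})"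
    and "\<And>p. p \<in> {p1..p2} \<Longrightarrow> norm (F p) \<le> K * (p - p1) powr (\<mu> - 1)"
    and "\<And>p. p \<in> {p1<..p2} \<Longrightarrow> norm (F' p) \<le> K * (p - p1) powr (\<mu> - 2)"
proof -
  obtain v where v: "continuous_on {p1..p2} v"
    and d: "\<And>p. p \<in> {p1..p2} \<Longrightarrow> (util has_vector_derivative v p) (at p within {p1..p2})"
    using C1 unfolding C1_on_def by blast
  have util: "continuous_on {p1..p2} util"
    using d by (rule continuous_on_vector_derivative)
  have "bounded (util ` {p1..p2} \<union> v ` {p1..p2})"
    using compact_continuous_image[OF util] compact_continuous_image[OF v]
    by (simp add: compact_imp_bounded)
  then obtain M where M: "\<And>p. p \<in> {p1..p2} \<Longrightarrow> norm (util p) \<le> M" "\<And>p. p \<in> {p1..p2} \<Longrightarrow> norm (v p) \<le> M"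
    unfolding bounded_iff by blast
  have M0: "M \<ge> 0" using order_trans[OF norm_ge_zero M(1)[of p1]] \<open>p1 < p2\<close> by simp
  define K where "K = M * (1 + (p2 - p1))"
  have MK: "M \<le> K" "M * (p2 - p1) + M \<le> K"
    using M0 \<open>p1 < p2\<close> by (auto simp: K_def distrib_left)
  define F' where "F' = (\<lambda>p. of_real ((p - p1) powr (\<mu> - 1)) * v p
      + of_real ((\<mu> - 1) * (p - p1) powr (\<mu> - 2)) * util p)"
  show thesis
  proof
    show "K \<ge> 0" using M0 MK by linarith
    show "continuous_on {p1<..p2} F'"
      unfolding F'_def
      by (intro continuous_intros continuous_on_powr' continuous_on_subset[OF v] continuous_on_subset[OF util]) auto
    show "(F has_vector_derivative F' p) (at p within {p1<..p2})" if p: "p \<in> {p1<..p2}" for p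
    proof -
      have "((\<lambda>p. (p - p1) powr (\<mu> - 1)) has_real_derivative (\<mu> - 1) * (p - p1) powr (\<mu> - 2)) (at p within {p1<..p2})"
        using p by (auto intro!: derivative_eq_intros)
      then have w: "((\<lambda>p. of_real ((p - p1) powr (\<mu> - 1)) :: complex) has_vector_derivative
          of_real ((\<mu> - 1) * (p - p1) powr (\<mu> - 2))) (at p within {p1<..p2})"
        by (intro has_vector_derivative_of_real) (simp only: has_real_derivative_iff_has_vector_derivative)
      show ?thesis
        unfolding F_def F'_def
        using p by (intro has_vector_derivative_mult[OF w] has_vector_derivative_within_subset[OF d]) auto
    qed
    show "norm (F p) \<le> K * (p - p1) powr (\<mu> - 1)" if "p \<in> {p1..p2}" for p
      using M(1)[OF that] MK mult_right_mono[of "norm (util p)" K "(p - p1) powr (\<mu> - 1)"]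
      by (simp add: F_def norm_mult mult.commute)
    show "norm (F' p) \<le> K * (p - p1) powr (\<mu> - 2)" if p: "p \<in> {p1<..p2}" for p
    proof -
      have p': "p \<in> {p1..p2}" using p by simp
      let ?w = "(p - p1) powr (\<mu> - 2)"
      \<comment> \<open>One power of \<open>p - p1\<close> is traded for the length
        \<open>p2 - p1\<close>, whence the form of \<open>K\<close>.\<close>
      have e: "(p - p1) powr (\<mu> - 1) = (p - p1) * ?w"
        using p powr_mult_base[of "p - p1" "\<mu> - 2"] by simp
      have "norm (F' p) \<le> (p - p1) powr (\<mu> - 1) * norm (v p) + \<bar>\<mu> - 1\<bar> * ?w * norm (util p)"
        unfolding F'_def by (rule norm_triangle_le) (simp add: norm_mult abs_mult del: of_real_mult of_real_diff)
      also have "\<dots> \<le> ((p2 - p1) * ?w) * M + 1 * ?w * M"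
        unfolding e using p \<mu> M0 by (intro add_mono mult_mono M[OF p']) auto
      also have "\<dots> = (M * (p2 - p1) + M) * ?w" by (simp add: algebra_simps)
      also have "\<dots> \<le> K * ?w" by (intro mult_right_mono MK) simp
      finally show ?thesis .
    qed
  qed
qed

section \<open>Comparison of norms on the growing interval\<close>

theorem corollary2p8:
  fixes \<mu> p1 p2 \<epsilon>1 \<epsilon>2 :: real
    and u0 Fu0 util :: "real \<Rightarrow> complex"
    and u :: "real \<Rightarrow> real \<Rightarrow> complex"
  assumes "1/2 < \<mu>" "\<mu> < 1"
    and "p1 < p2"
    and "has_fourier_transform u0 Fu0"
    and "\<And>p. p \<notin> {p1..p2} \<Longrightarrow> Fu0 p = 0"
    and "\<And>p. p \<in> {p1<..p2} \<Longrightarrow> Fu0 p = of_real ((p - p1) powr (\<mu> - 1)) * util p"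
    and "C1_on {p1..p2} util"
    and "util p1 \<noteq> 0"
    and "Fu0 p2 = 0"
    and "u = schrodinger_solution p1 p2 Fu0"
    and "\<epsilon>1 > 0" "\<epsilon>2 > 0"
    and "p1 + \<epsilon>1 < p2 - \<epsilon>2"
  shows "\<exists>c\<ge>0. \<forall>t\<ge>1.
           \<bar>L2_norm_on {2 * (p1 + \<epsilon>1) * t .. 2 * (p2 - \<epsilon>2) * t} (u t)
             - 1 / sqrt (2 * pi) * L2_norm_on {p1 + \<epsilon>1 <..< p2 - \<epsilon>2} Fu0\<bar>
           \<le> c * t powr (1/2 - \<mu>)"
proof -
  \<comment> \<open>On \<open>{p1..p2}\<close> this can differ from \<open>Fu0\<close> only at
    \<open>p1\<close>, where \<open>F\<close> takes the value 0 by the convention for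
    \<open>powr\<close>; one point affects no integral.\<close>
  define F where "F = (\<lambda>p. of_real ((p - p1) powr (\<mu> - 1)) * util p)"
  define a where "a = p1 + \<epsilon>1"
  define b where "b = p2 - \<epsilon>2"
  have ab: "p1 < a" "a < b" "b < p2" using assms by (auto simp: a_def b_def)
  have \<mu>: "0 < \<mu>" "\<mu> < 1" using assms by auto
  have FF: "Fu0 p = F p" if "p \<in> {p1<..p2}" for p
    using assms(6)[OF that] by (simp add: F_def)
  obtain F' K where K: "K \<ge> 0" and F': "continuous_on {p1<..p2} F'"
    and dF: "\<And>p. p \<in> {p1<..p2} \<Longrightarrow> (F has_vector_derivative F' p) (at p within {p1<..p2})"
    and bF: "\<And>p. p \<in> {p1..p2} \<Longrightarrow> norm (F p) \<le> K * (p - p1) powr (\<mu> - 1)"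
    and bF': "\<And>p. p \<in> {p1<..p2} \<Longrightarrow> norm (F' p) \<le> K * (p - p1) powr (\<mu> - 2)"
    by (rule singular_density_bounds[OF \<mu> \<open>p1 < p2\<close> \<open>C1_on {p1..p2} util\<close> F_def]) (rule that)
  have iFu: "Fu0 absolutely_integrable_on {p1..p2}"
    using assms(4) by (intro square_integrable_imp_absolutely_integrable) (simp add: has_fourier_transform_def)
  have iF: "F absolutely_integrable_on {p1..p2}"
    by (rule absolutely_integrable_spike[OF iFu negligible_sing[of p1]]) (use FF in auto)
  have "F p2 = 0" using FF[of p2] assms by simp
  \<comment> \<open>The constant of \<open>singular_stationary_phase\<close> for
    \<open>\<delta> = \<epsilon>1 / 2\<close>, the choice that makes
    \<open>p1 + 2 * \<delta> \<le> q\<close> hold for all \<open>q \<ge> a\<close>.\<close>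
  define C where "C = K * (\<epsilon>1 / 2) powr \<mu> / \<mu> +
      K * (\<epsilon>1 / 2) powr (\<mu> - 2) * (2 + 4 / (1 - \<mu>) + 4 * ln (1 + (p2 - p1)))"
  have C: "C \<ge> 0" unfolding C_def using K \<mu> assms
    by (intro add_nonneg_nonneg mult_nonneg_nonneg divide_nonneg_nonneg) auto
  have cF: "continuous_on {a..b} F"
    using ab by (intro continuous_on_subset[OF continuous_on_vector_derivative[OF dF]]) auto
  have cFu: "continuous_on {a..b} Fu0"
    using cF ab FF by (subst continuous_on_cong[OF refl, of _ _ F]) auto
  define N where "N = integral {a..b} (\<lambda>p. (norm (F p))\<^sup>2)"
  have normF: "L2_norm_on {a<..<b} Fu0 = sqrt N"
    unfolding L2_norm_on_continuous(2)[OF cFu] N_def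
    using ab FF by (intro arg_cong[where f=sqrt] integral_cong) auto
  show ?thesis
  \<comment> \<open>The witness combines the pointwise error
    \<open>C / (2 * pi) * t powr - \<mu>\<close> with the square root of the length
    \<open>2 * (b - a) * t\<close>, whose factor \<open>sqrt t\<close> goes into the rate.\<close>
  proof (intro exI[of _ "C / (2 * pi) * sqrt (2 * (b - a))"] conjI allI impI)
    show "C / (2 * pi) * sqrt (2 * (b - a)) \<ge> 0" using C ab by simp
    fix t :: real assume t1: "t \<ge> 1"
    then have t: "t > 0" by simp
    define X where "X = {2 * a * t..2 * b * t}"
    \<comment> \<open>The modulus of the leading term,
      \<open>norm (2 * F q * osc_tail t 0) / (2 * pi)\<close> at
      \<open>q = x / (2 * t)\<close>.\<close>
    define g where "g = (\<lambda>x. norm (F (x / (2 * t))) * (sqrt (pi / t) / (2 * pi)))"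
    define e where "e = C / (2 * pi) * t powr - \<mu>"
    have e0: "e \<ge> 0" using C by (simp add: e_def)
    have Xt: "2 * a * t < 2 * b * t" using ab t by simp
    have q: "x / (2 * t) \<in> {a..b}" if "x \<in> X" for x
      using that t by (auto simp: X_def field_simps)
    have point: "\<bar>norm (u t x) - g x\<bar> \<le> e" if "x \<in> X" for x
    proof -
      define q where "q = x / (2 * t)"
      have q: "q \<in> {a..b}" using q[OF that] by (simp add: q_def)
      let ?J = "\<lambda>F. integral {p1..p2} (\<lambda>p. F p * cis (- t * (p - q)\<^sup>2))"
      have J: "?J Fu0 = ?J F"
        by (rule integral_spike[OF negligible_sing[of p1]]) (use FF in auto)
      have "norm (?J F - 2 * F q * osc_tail t 0) \<le> C * t powr - \<mu>"
        unfolding C_def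
        by (rule singular_stationary_phase[OF \<mu> _ K t1 _ _ iF dF F' bF bF' \<open>F p2 = 0\<close>])
          (use q assms in \<open>auto simp: a_def b_def\<close>)
      then have "\<bar>norm (?J F) - norm (2 * F q * osc_tail t 0)\<bar> \<le> C * t powr - \<mu>"
        using norm_triangle_ineq3 order_trans by blast
      moreover have "norm (2 * F q * osc_tail t 0) = norm (F q) * sqrt (pi / t)"
        using norm_osc_tail_0[OF t] by (simp add: norm_mult)
      ultimately have "\<bar>norm (?J F) - norm (F q) * sqrt (pi / t)\<bar> / (2 * pi) \<le> C * t powr - \<mu> / (2 * pi)"
        by (intro divide_right_mono) auto
      moreover have "norm (u t x) - g x = (norm (?J F) - norm (F q) * sqrt (pi / t)) / (2 * pi)"
        unfolding assms(10) norm_schrodinger_solution[OF iFu t] q_def[symmetric] J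
        by (simp add: g_def q_def diff_divide_distrib)
      ultimately show ?thesis by (simp add: e_def abs_divide)
    qed
    have cu: "continuous_on X (u t)"
      unfolding assms(10) by (rule continuous_on_schrodinger_solution[OF iFu])
    have cg: "continuous_on X g"
      unfolding g_def using t q
      by (intro continuous_intros continuous_on_compose2[OF cF]) auto
    have "\<bar>sqrt (integral X (\<lambda>x. (norm (u t x))\<^sup>2)) - sqrt (integral X (\<lambda>x. (g x)\<^sup>2))\<bar>
        \<le> e * sqrt (2 * b * t - 2 * a * t)"
    proof (rule abs_leI)
      have "sqrt (integral X (\<lambda>x. (norm (u t x))\<^sup>2)) \<le> sqrt (integral X (\<lambda>x. (g x)\<^sup>2)) + e * sqrt (2 * b * t - 2 * a * t)"
        unfolding X_def
        by (rule sqrt_integral_power2_le[OF Xt continuous_on_norm[OF cu[unfolded X_def]] cg[unfolded X_def] _ e0])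
          (use point[unfolded X_def abs_le_iff] in \<open>auto simp: diff_le_eq add.commute\<close>)
      then show "sqrt (integral X (\<lambda>x. (norm (u t x))\<^sup>2)) - sqrt (integral X (\<lambda>x. (g x)\<^sup>2))
          \<le> e * sqrt (2 * b * t - 2 * a * t)" by simp
      have "sqrt (integral X (\<lambda>x. (g x)\<^sup>2)) \<le> sqrt (integral X (\<lambda>x. (norm (u t x))\<^sup>2)) + e * sqrt (2 * b * t - 2 * a * t)"
        unfolding X_def
        by (rule sqrt_integral_power2_le[OF Xt cg[unfolded X_def] continuous_on_norm[OF cu[unfolded X_def]] _ e0])
          (use t point[unfolded X_def abs_le_iff] in \<open>auto simp: g_def diff_le_eq add.commute\<close>)
      then show "- (sqrt (integral X (\<lambda>x. (norm (u t x))\<^sup>2)) - sqrt (integral X (\<lambda>x. (g x)\<^sup>2)))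
          \<le> e * sqrt (2 * b * t - 2 * a * t)" by simp
    qed
    \<comment> \<open>The substitution \<open>x = 2 * t * p\<close> contributes
      \<open>2 * t\<close>, which cancels against the squared amplitude
      \<open>1 / (4 * pi * t)\<close>; the norm of \<open>g\<close> is thus the same for all
      \<open>t\<close>.\<close>
    moreover have "sqrt (integral X (\<lambda>x. (g x)\<^sup>2)) = 1 / sqrt (2 * pi) * sqrt N"
    proof -
      have "((\<lambda>p. (norm (F p))\<^sup>2) has_integral N) (cbox a b)"
        unfolding N_def cbox_interval
        by (intro integrable_integral integrable_continuous_real continuous_intros cF)
      from has_integral_affinity'[OF this, of "1 / (2 * t)" 0]
      have "((\<lambda>x. (norm (F (x / (2 * t))))\<^sup>2) has_integral 2 * t * N) X"
        using t by (simp add: X_def mult_ac)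
      from has_integral_mult_left[OF this, of "(sqrt (pi / t) / (2 * pi))\<^sup>2"]
      have "integral X (\<lambda>x. (g x)\<^sup>2) = 2 * t * N * (sqrt (pi / t) / (2 * pi))\<^sup>2"
        unfolding g_def power_mult_distrib by (rule integral_unique)
      also have "\<dots> = 1 / (2 * pi) * N"
        using t by (simp add: power_divide field_simps power2_eq_square)
      finally show ?thesis by (simp add: real_sqrt_divide real_sqrt_mult)
    qed
    moreover have "e * sqrt (2 * b * t - 2 * a * t) = C / (2 * pi) * sqrt (2 * (b - a)) * t powr (1/2 - \<mu>)"
    proof -
      have "2 * b * t - 2 * a * t = 2 * (b - a) * t" by (simp add: algebra_simps)
      then have "sqrt (2 * b * t - 2 * a * t) = sqrt (2 * (b - a)) * t powr (1/2)"
        using t by (simp add: real_sqrt_mult powr_half_sqrt)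
      moreover have "t powr (1/2 - \<mu>) = t powr (1/2) * t powr - \<mu>"
        by (simp flip: powr_add)
      ultimately show ?thesis by (simp only: e_def mult_ac)
    qed
    ultimately show "\<bar>L2_norm_on {2 * (p1 + \<epsilon>1) * t..2 * (p2 - \<epsilon>2) * t} (u t)
        - 1 / sqrt (2 * pi) * L2_norm_on {p1 + \<epsilon>1<..<p2 - \<epsilon>2} Fu0\<bar>
        \<le> C / (2 * pi) * sqrt (2 * (b - a)) * t powr (1/2 - \<mu>)"
      using normF L2_norm_on_continuous(1)[OF cu[unfolded X_def]]
      by (simp only: a_def[symmetric] b_def[symmetric] X_def)
  qed
qed

end
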